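(* (Convergence of tabular Ensemble, Averaged and Historical Best Q-learning.) Consider a finite Markov decision process and the iteration specified in the context, with $N,K\ge1$ and one of the following choices of bootstrap value $B_s(t)$: (a) Ensemble Q-learning: $K=1$, $N\ge1$ arbitrary, $B_s(t)=\max_{a\in\mathcal{A}}\frac1N\sum_{i=1}^NQ^i_{sa}(t)$; (b) Averaged Q-learning: $N=1$, $K\ge1$ arbitrary, $B_s(t)=\max_{a\in\mathcal{A}}\frac1K\sum_{j=0}^{K-1}Q^1_{sa}(t-j)$; (c) Historical Best Q-learning: $N=1$, $K\ge1$ arbitrary, $B_s(t)=\max_{a\in\mathcal{A}}\max_{0\le j\le K-1}Q^1_{sa}(t-j)$. Assume there is a deterministic constant $C$ such that for every $(s,a)\in\mathcal{S}\times\mathcal{A}$ and $i\in\{1,\dots,N\}$, $0\le\alpha^i_{sa}(t)\le1$ for all $t$ and, with probability $1$, $\sum_{t=0}^\infty(\alpha^i_{sa}(t))^2\le C$ and $\sum_{t=0}^\infty\alpha^i_{sa}(t)=\infty$. Then, with probability $1$, $Q^i_{sa}(t)\to Q^*_{sa}$ as $t\to\infty$ for all $i$ and all $(s,a)$, where $Q^*$ is the optimal action-value function, in either of the following cases: (i) $\gamma<1$; (ii) $\gamma=1$, there is an absorbing reward-free state $s_1$, the initial action values at $s_1$ are zero for all $a$ and $i$, and all stationary policies are proper.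
   Context: **MDP.** $\mathcal{S}$ and $\mathcal{A}$ are finite sets. For $s\in\mathcal{S}$, $a\in\mathcal{A}$, $p_{ss'}(a)\ge0$ with $\sum_{s'}p_{ss'}(a)=1$ are the transition probabilities, and $r_{sa}$ is a random reward with finite variance. $\gamma\in[0,1]$ is the discount factor. A stationary policy is a map $\pi:\mathcal{S}\to\mathcal{A}$; it induces a Markov chain with transition probabilities $p_{ss'}(\pi(s))$. The value $V^\pi_s$ is the limit as $T\to\infty$ of the expected sum $E[\sum_{t=0}^T\gamma^t r_{s_t,\pi(s_t)}\mid s_0=s]$ along this chain $(s_t)$, $V^*_s=\sup_\pi V^\pi_s$, and the optimal action-value function is $Q^*_{sa}=E[r_{sa}]+\gamma\sum_{s'}p_{ss'}(a)V^*_{s'}$. A state $s_1$ is absorbing and reward-free if $p_{s_1s_1}(a)=1$ and $r_{s_1a}=0$ for all $a$. A stationary policy is proper if, from every initial state, the probability of being at $s_1$ at time $t$ tends to $1$ as $t\to\infty$. **Iteration (tabular).** There are $N$ action-value estimates $Q^1(t),\dots,Q^N(t)\in\mathbb{R}^{\mathcal{S}\times\mathcal{A}}$ with given initial values at times $-K+1\le t\le0$ (all zero at $s_1$ in case (ii)). For $t\ge0$ and every $(s,a)$ and $i$, $$Q^i_{sa}(t+1)=Q^i_{sa}(t)+\alpha^i_{sa}(t)\big[r_{sa}(t)+\gamma B_{f(s,a)}(t)-Q^i_{sa}(t)\big],$$ where $r_{sa}(t)$ is a random sample of $r_{sa}$ and $f(s,a)$ is a random successor state sampled at time $t$, equal to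 $s'$ with probability $p_{ss'}(a)$. The step-size $\alpha^i_{sa}(t)$ is zero when $Q^i_{sa}$ is not updated at iteration $t$. All samples are drawn independently; $\alpha^i_{sa}(t)$ may be random but is measurable with respect to the history $\mathcal{F}(t)$ of the algorithm up to the selection of the step-sizes of iteration $t$ (before the samples of iteration $t$ are drawn). $\mathcal{F}(t)$ is increasing, the initial values are $\mathcal{F}(0)$-measurable, and the samples of iteration $t$ are $\mathcal{F}(t+1)$-measurable and, conditionally on $\mathcal{F}(t)$, have the stated laws. *)

theory Defs
  imports "HOL-Probability.Probability"
begin

text \<open>
  A finite Markov decision process is given by the transition laws \<open>p s a\<close> on the finite type of
  states, the reward laws \<open>R s a\<close> on the reals, and the discount factor \<open>\<gamma>\<close>.
\<close>

text \<open>Law of \<open>[s\<^sub>0, \<dots>, s\<^sub>T]\<close> for the chain induced by \<open>\<pi>\<close> with \<open>s\<^sub>0 = s\<close>.\<close>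

primrec trajectory :: "('s \<Rightarrow> 'a \<Rightarrow> 's pmf) \<Rightarrow> ('s \<Rightarrow> 'a) \<Rightarrow> 's \<Rightarrow> nat \<Rightarrow> 's list pmf" where
  "trajectory p \<pi> s 0 = return_pmf [s]"
| "trajectory p \<pi> s (Suc T) =
     bind_pmf (trajectory p \<pi> s T)
       (\<lambda>xs. map_pmf (\<lambda>s'. xs @ [s']) (p (last xs) (\<pi> (last xs))))"

text \<open>
  The expectation of \<open>\<Sum>t\<le>T. \<gamma>^t * r\<^sub>t\<close>, where \<open>r\<^sub>t\<close> is the reward of the pair visited at time \<open>t\<close>.
  The rewards are read off a table \<open>\<rho>\<close> of independent entries \<open>\<rho> (t, s, a)\<close> with laws \<open>R s a\<close>,
  so that rewards at different times are fresh draws.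
\<close>

definition expected_return ::
  "('s::finite \<Rightarrow> 'a::finite \<Rightarrow> real measure) \<Rightarrow> ('s \<Rightarrow> 'a \<Rightarrow> 's pmf) \<Rightarrow> real \<Rightarrow> ('s \<Rightarrow> 'a) \<Rightarrow> 's \<Rightarrow> nat \<Rightarrow> real"
  where
  "expected_return R p \<gamma> \<pi> s T =
     (\<integral>z. (\<Sum>t\<le>T. \<gamma> ^ t * snd z (t, fst z ! t, \<pi> (fst z ! t)))
        \<partial>(measure_pmf (trajectory p \<pi> s T)
            \<Otimes>\<^sub>M (\<Pi>\<^sub>M k\<in>{..T} \<times> UNIV \<times> UNIV. R (fst (snd k)) (snd (snd k)))))"

definition policy_value ::
  "('s::finite \<Rightarrow> 'a::finite \<Rightarrow> real measure) \<Rightarrow> ('s \<Rightarrow> 'a \<Rightarrow> 's pmf) \<Rightarrow> real \<Rightarrow> ('s \<Rightarrow> 'a) \<Rightarrow> 's \<Rightarrow> real"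
  where
  "policy_value R p \<gamma> \<pi> s = lim (\<lambda>T. expected_return R p \<gamma> \<pi> s T)"

definition optimal_value ::
  "('s::finite \<Rightarrow> 'a::finite \<Rightarrow> real measure) \<Rightarrow> ('s \<Rightarrow> 'a \<Rightarrow> 's pmf) \<Rightarrow> real \<Rightarrow> 's \<Rightarrow> real"
  where
  "optimal_value R p \<gamma> s = (SUP \<pi>. policy_value R p \<gamma> \<pi> s)"

definition optimal_action_value ::
  "('s::finite \<Rightarrow> 'a::finite \<Rightarrow> real measure) \<Rightarrow> ('s \<Rightarrow> 'a \<Rightarrow> 's pmf) \<Rightarrow> real \<Rightarrow> 's \<Rightarrow> 'a \<Rightarrow> real"
  where
  "optimal_action_value R p \<gamma> s a =
     (\<integral>x. x \<partial>R s a) + \<gamma> * (\<Sum>s'\<in>UNIV. pmf (p s a) s' * optimal_value R p \<gamma> s')"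

definition absorbing_reward_free ::
  "('s \<Rightarrow> 'a \<Rightarrow> real measure) \<Rightarrow> ('s \<Rightarrow> 'a \<Rightarrow> 's pmf) \<Rightarrow> 's \<Rightarrow> bool" where
  "absorbing_reward_free R p s1 \<longleftrightarrow> (\<forall>a. pmf (p s1 a) s1 = 1 \<and> (AE x in R s1 a. x = 0))"

definition proper_policy ::
  "('s \<Rightarrow> 'a \<Rightarrow> 's pmf) \<Rightarrow> 's \<Rightarrow> ('s \<Rightarrow> 'a) \<Rightarrow> bool" where
  "proper_policy p s1 \<pi> \<longleftrightarrow>
     (\<forall>s. (\<lambda>t. measure_pmf.prob (trajectory p \<pi> s t) {xs. xs ! t = s1}) \<longlonglongrightarrow> 1)"

text \<open>
  Bootstrap values, as functions of the estimates \<open>q i t s a\<close>. Estimators are numbered from 1.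
  Time is an integer because initial values at negative times are needed.
\<close>

definition ensemble_bootstrap ::
  "nat \<Rightarrow> (nat \<Rightarrow> int \<Rightarrow> 's \<Rightarrow> 'a::finite \<Rightarrow> real) \<Rightarrow> int \<Rightarrow> 's \<Rightarrow> real" where
  "ensemble_bootstrap N q t s = (MAX a. 1 / real N * (\<Sum>i=1..N. q i t s a))"

definition averaged_bootstrap ::
  "nat \<Rightarrow> (nat \<Rightarrow> int \<Rightarrow> 's \<Rightarrow> 'a::finite \<Rightarrow> real) \<Rightarrow> int \<Rightarrow> 's \<Rightarrow> real" where
  "averaged_bootstrap K q t s = (MAX a. 1 / real K * (\<Sum>j<K. q 1 (t - int j) s a))"

definition historical_best_bootstrap ::
  "nat \<Rightarrow> (nat \<Rightarrow> int \<Rightarrow> 's \<Rightarrow> 'a::finite \<Rightarrow> real) \<Rightarrow> int \<Rightarrow> 's \<Rightarrow> real" where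
  "historical_best_bootstrap K q t s = (MAX a. MAX j\<in>{..<K}. q 1 (t - int j) s a)"

text \<open>Conditionally on the sub-\<open>\<sigma>\<close>-algebra \<open>G\<close>, the random element \<open>X\<close> has the (deterministic) law \<open>D\<close>.\<close>

definition has_cond_law :: "'w measure \<Rightarrow> 'w measure \<Rightarrow> ('w \<Rightarrow> 'b) \<Rightarrow> 'b measure \<Rightarrow> bool" where
  "has_cond_law M G X D \<longleftrightarrow>
     X \<in> measurable M D \<and>
     (\<forall>B\<in>sets D. AE \<omega> in M.
        real_cond_exp M G (indicator (X -` B \<inter> space M)) \<omega> = measure D B)"

text \<open>
  Joint law of the samples of one iteration: for every \<open>(s, a)\<close> a reward and a successor state,
  all of them independent. With conditioning on an increasing history to which the earlier samples
  belong, this also makes samples of different iterations independent.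
\<close>

definition sample_law ::
  "('s::finite \<Rightarrow> 'a::finite \<Rightarrow> real measure) \<Rightarrow> ('s \<Rightarrow> 'a \<Rightarrow> 's pmf) \<Rightarrow> ('s \<times> 'a \<Rightarrow> real \<times> 's) measure"
  where
  "sample_law R p = (\<Pi>\<^sub>M k\<in>UNIV. R (fst k) (snd k) \<Otimes>\<^sub>M measure_pmf (p (fst k) (snd k)))"

end

theory Submission
  imports Defs
begin

text \<open>
  Measure the errors of the estimates, current and delayed, in a weighted maximum norm in which the
  expected Bellman update contracts by a factor \<open>\<beta> < 1\<close>: for \<open>\<gamma> < 1\<close> all weights are 1, and for
  \<open>\<gamma> = 1\<close> a state has weight \<open>1 - \<delta>^l\<close>, where \<open>l\<close> is a level that some successor always lowers.
  All three bootstrap values are nonexpansive in this norm.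

  Let \<open>m t\<close> be the running maximum of 1 and the past errors. After division by \<open>m t\<close> the sampling noise has
  bounded conditional variance, so its step-size weighted sum is an \<open>L\<^sup>2\<close>-bounded martingale and
  converges almost surely, before anything is known about the growth of the iterates. Let \<open>D t\<close> be
  minus the remainder of that convergent series. Along a path, subtracting \<open>m t * D t\<close> from the error
  \<open>x t\<close> turns the recursion into a convex combination, perturbed by \<open>o(m t)\<close>. Hence
  \<open>\<bar>x t\<bar> \<le> L + (\<beta> + 2 * \<epsilon>) * m t\<close>, which bounds the maximum \<open>m\<close>; then any asymptotic bound \<open>A\<close>
  on the errors improves to \<open>(1 + \<beta>) / 2 * A\<close>.
\<close>

section \<open>Asynchronous relaxation towards a contraction\<close>

text \<open>The obstacle is a circle: the sampling noise of a bootstrap target is as large as the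
  estimates, so a variance bound seems to need bounded estimates, while boundedness is usually
  derived from controlled noise. Division by \<open>m t\<close> breaks the circle because
  \<open>m t\<close> is known from the history at time \<open>t\<close>: the divided noise still has
  predictable coefficients. The entry 1 in the maximum accounts for the reward noise and the optimal
  values, which do not shrink with the errors. The deterministic \<open>C\<close> makes the
  martingale bounded in L2: it bounds the expected sum of squared steps although the steps are
  random. The noise is split into a reward term and one indicator term per successor state. Each has
  a fixed law independent of the history, and bootstrap values occur only as coefficients, so that
  all moments factor into products of expectations. Boundedness has to come first: until
  \<open>m\<close> is bounded, convergence of the divided noise series does not give convergence of
  the undivided one. At weight 0 no error can be measured; there the estimates almost surely stay 0,
  which is proved separately.\<close>

lemma relaxation_tendsto_0:
  fixes h a :: "nat \<Rightarrow> real"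
  assumes a: "\<And>t. 0 \<le> a t" "\<And>t. a t \<le> 1"
    and div: "filterlim (\<lambda>n. \<Sum>t<n. a t) at_top sequentially"
    and nonneg: "\<And>t. t \<ge> T \<Longrightarrow> 0 \<le> h t"
    and step: "\<And>t. t \<ge> T \<Longrightarrow> h (Suc t) \<le> (1 - a t) * h t"
  shows "h \<longlonglongrightarrow> 0"
proof -
  \<comment> \<open>By \<open>1 - a t \<le> exp (- a t)\<close>, \<open>h\<close> decays like the
    exponential of minus the partial sums. The factor in \<open>H\<close> compensates the steps
    before \<open>T\<close>, so that the sums may start at 0.\<close>
  define H where "H = h T * exp (\<Sum>t<T. a t)"
  have bound: "h t \<le> H * exp (- (\<Sum>\<tau><t. a \<tau>))" if "t \<ge> T" for t
    using that
  proof (induction t rule: dec_induct)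
    case base
    then show ?case by (simp add: H_def exp_minus field_simps)
  next
    case (step t)
    have "h (Suc t) \<le> (1 - a t) * h t"
      using assms(5)[OF step.hyps(1)] .
    also have "\<dots> \<le> exp (- a t) * h t"
      using nonneg[OF step.hyps(1)] exp_ge_add_one_self[of "- a t"] by (intro mult_right_mono) auto
    also have "\<dots> \<le> exp (- a t) * (H * exp (- (\<Sum>\<tau><t. a \<tau>)))"
      using step.IH by (intro mult_left_mono) auto
    also have "\<dots> = H * exp (- (\<Sum>\<tau><Suc t. a \<tau>))"
      by (simp add: exp_add[symmetric] mult.left_commute)
    finally show ?case .
  qed
  have "(\<lambda>t. exp (- (\<Sum>\<tau><t. a \<tau>))) \<longlonglongrightarrow> 0"
    using filterlim_compose[OF exp_at_bot, of "\<lambda>t. - sum a {..<t}"] div by (simp add: filterlim_uminus_at_bot)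
  then have "(\<lambda>t. H * exp (- (\<Sum>\<tau><t. a \<tau>))) \<longlonglongrightarrow> 0"
    using tendsto_mult_right_zero by blast
  then show ?thesis
  proof (rule tendsto_sandwich[rotated 3])
    show "eventually (\<lambda>t. 0 \<le> h t) sequentially"
      "eventually (\<lambda>t. h t \<le> H * exp (- (\<Sum>\<tau><t. a \<tau>))) sequentially"
      using nonneg bound by (auto simp: eventually_sequentially)
  qed simp
qed

text \<open>Abel summation: the remainders \<open>D\<close> are bounded and tend to 0, and the
  increments of \<open>m\<close> are absolutely summable because they telescope. This restores the
  factor \<open>m t\<close> to the noise once \<open>m\<close> is known to be bounded.\<close>

lemma convergent_sum_mult_monotone:
  fixes d m :: "nat \<Rightarrow> real"
  assumes conv: "convergent (\<lambda>n. \<Sum>t<n. d t)" and m: "incseq m" "\<And>t. m t \<le> U"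
  shows "convergent (\<lambda>n. \<Sum>t<n. m t * d t)"
proof -
  obtain L where L: "(\<lambda>n. \<Sum>t<n. d t) \<longlonglongrightarrow> L" using conv by (auto simp: convergent_def)
  define D where "D n = (\<Sum>t<n. d t) - L" for n
  have D: "D \<longlonglongrightarrow> 0" unfolding D_def using LIM_zero[OF L] .
  then obtain b where b: "\<And>n. \<bar>D n\<bar> \<le> b"
    using convergent_imp_Bseq[of D] by (auto simp: convergent_def Bseq_def)
  have cm: "convergent m"
    using incseq_bounded[OF m(1)] m(2) by (intro Bseq_monoseq_convergent) (auto simp: incseq_imp_monoseq m(1))
  then have "summable (\<lambda>t. m (Suc t) - m t)"
    using telescope_summable by (auto simp: convergent_def)
  then have "summable (\<lambda>t. b * (m (Suc t) - m t))" by (rule summable_mult)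
  then have "summable (\<lambda>t. (m (Suc t) - m t) * D (Suc t))"
  proof (rule summable_comparison_test'[where N=0])
    fix t
    have inc: "0 \<le> m (Suc t) - m t" using m(1) by (simp add: incseq_SucD)
    then show "norm ((m (Suc t) - m t) * D (Suc t)) \<le> b * (m (Suc t) - m t)"
      using mult_right_mono[OF b[of "Suc t"] inc] by (simp add: abs_mult mult.commute)
  qed
  then have 1: "convergent (\<lambda>n. \<Sum>t<n. (m (Suc t) - m t) * D (Suc t))"
    by (simp add: summable_iff_convergent)
  have 2: "convergent (\<lambda>n. m n * D n)"
    using cm D by (intro convergent_mult) (auto simp: convergent_def)
  have "(\<Sum>t<n. m t * d t) = m n * D n - m 0 * D 0 - (\<Sum>t<n. (m (Suc t) - m t) * D (Suc t))" for n
    by (induction n) (auto simp: D_def algebra_simps)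
  then show ?thesis
    using 1 2 by (simp add: convergent_diff convergent_const)
qed

lemma convergent_sum_tail:
  fixes d :: "nat \<Rightarrow> real"
  assumes "convergent (\<lambda>n. \<Sum>t<n. d t)"
  obtains D where "\<And>n. D (Suc n) = D n + d n" "D \<longlonglongrightarrow> 0"
proof -
  obtain L where L: "(\<lambda>n. \<Sum>t<n. d t) \<longlonglongrightarrow> L" using assms by (auto simp: convergent_def)
  show ?thesis
    by (rule that[of "\<lambda>n. (\<Sum>t<n. d t) - L"]) (auto intro: LIM_zero L)
qed

lemma async_contraction_bounded:
  fixes x g v a :: "'k \<Rightarrow> nat \<Rightarrow> real" and m :: "nat \<Rightarrow> real"
  assumes I: "finite I" and \<beta>: "0 \<le> \<beta>" "\<beta> < 1"
    and a: "\<And>k t. k \<in> I \<Longrightarrow> 0 \<le> a k t \<and> a k t \<le> 1"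
    and rec: "\<And>k t. k \<in> I \<Longrightarrow> x k (Suc t) = (1 - a k t) * x k t + a k t * (g k t + m t * v k t)"
    and g: "\<And>k t. k \<in> I \<Longrightarrow> \<bar>g k t\<bar> \<le> \<beta> * m t"
    and m: "incseq m" "\<And>t. 0 \<le> m t" "\<And>k t. k \<in> I \<Longrightarrow> \<bar>x k t\<bar> \<le> m t"
      "\<And>t. m (Suc t) \<le> m t \<or> (\<exists>k\<in>I. m (Suc t) \<le> \<bar>x k (Suc t)\<bar>)"
    and conv: "\<And>k. k \<in> I \<Longrightarrow> convergent (\<lambda>n. \<Sum>t<n. a k t * v k t)"
  shows "\<exists>U. \<forall>t. m t \<le> U"
proof -
  \<comment> \<open>Any positive \<open>\<epsilon>\<close> with
    \<open>\<beta> + 2 * \<epsilon> < 1\<close> would do: one \<open>\<epsilon>\<close> is spent on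
    \<open>D\<close> in the bound of \<open>y\<close>, the other on returning from \<open>y\<close>
    to \<open>x\<close>.\<close>
  define \<epsilon> where "\<epsilon> = (1 - \<beta>) / 4"
  have \<epsilon>: "\<epsilon> > 0" "1 - \<beta> - 2 * \<epsilon> > 0" using \<beta> by (auto simp: \<epsilon>_def field_simps)
  have "\<forall>k\<in>I. \<exists>D. (\<forall>n. D (Suc n) = D n + a k n * v k n) \<and> D \<longlonglongrightarrow> 0"
    using convergent_sum_tail[OF conv] by metis
  then obtain D where D: "\<And>k n. k \<in> I \<Longrightarrow> D k (Suc n) = D k n + a k n * v k n"
    "\<And>k. k \<in> I \<Longrightarrow> D k \<longlonglongrightarrow> 0"
    by (auto dest!: bchoice)
  have "eventually (\<lambda>t. \<bar>D k t\<bar> < \<epsilon>) sequentially" if "k \<in> I" for k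
    using D(2)[OF that] \<epsilon>(1) by (simp add: tendsto_iff dist_real_def)
  then have "eventually (\<lambda>t. \<forall>k\<in>I. \<bar>D k t\<bar> < \<epsilon>) sequentially"
    using I by (simp add: eventually_ball_finite_distrib)
  then obtain t0 where t0: "\<And>t k. t \<ge> t0 \<Longrightarrow> k \<in> I \<Longrightarrow> \<bar>D k t\<bar> \<le> \<epsilon>"
    by (auto simp: eventually_sequentially intro: less_imp_le)
  define y where "y k t = x k t - m t * D k t" for k t
  have mD: "\<bar>m t * D k t\<bar> \<le> \<epsilon> * m t" if "k \<in> I" "t \<ge> t0" for k t
    using mult_left_mono[OF t0[OF that(2,1)] m(2)[of t]] m(2)[of t] by (simp add: abs_mult mult.commute)
  define L where "L = (1 + \<epsilon>) * m t0"
  \<comment> \<open>An increase of \<open>m\<close> costs only \<open>\<epsilon>\<close> times that increase, so the total cost is at most \<open>\<epsilon> * m t\<close>.\<close>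
  have y: "\<bar>y k t\<bar> \<le> L + (\<beta> + \<epsilon>) * m t" if "k \<in> I" "t \<ge> t0" for k t
    using that(2)
  proof (induction t rule: dec_induct)
    case base
    have "\<bar>y k t0\<bar> \<le> m t0 + \<epsilon> * m t0"
      unfolding y_def using m(3)[OF that(1), of t0] mD[OF that(1), of t0] by linarith
    moreover have "0 \<le> (\<beta> + \<epsilon>) * m t0" using \<beta> \<epsilon> m(2) by simp
    ultimately show ?case by (simp add: L_def algebra_simps)
  next
    case (step t)
    let ?a = "a k t" and ?c = "L + (\<beta> + \<epsilon>) * m t"
    \<comment> \<open>With the remainder scaled by \<open>m t\<close>, its increment cancels the
      noise term exactly. What is left is the old remainder inside the target and the change of
      \<open>m\<close>.\<close>
    have "m t * D k (Suc t) = m t * D k t + ?a * (m t * v k t)"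
      using D(1)[OF that(1)] by (simp add: algebra_simps)
    then have eq: "y k (Suc t) = (1 - ?a) * y k t + ?a * (g k t - m t * D k t) - (m (Suc t) - m t) * D k (Suc t)"
      using rec[OF that(1), of t] by (simp add: y_def algebra_simps)
    have a': "0 \<le> ?a" "0 \<le> 1 - ?a" using a[OF that(1)] by auto
    have "\<bar>(1 - ?a) * y k t\<bar> \<le> (1 - ?a) * ?c"
      using a' step.IH by (simp add: abs_mult mult_left_mono)
    moreover have "\<bar>g k t - m t * D k t\<bar> \<le> ?c"
    proof -
      have "0 \<le> L" using m(2) \<epsilon> by (simp add: L_def)
      then show ?thesis using g[OF that(1), of t] mD[OF that(1) step.hyps(1)] by (simp add: algebra_simps)
    qed
    then have "\<bar>?a * (g k t - m t * D k t)\<bar> \<le> ?a * ?c"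
      using a' by (simp add: abs_mult mult_left_mono)
    moreover have "\<bar>(m (Suc t) - m t) * D k (Suc t)\<bar> \<le> (m (Suc t) - m t) * (\<beta> + \<epsilon>)"
    proof -
      have "0 \<le> m (Suc t) - m t" using m(1) by (simp add: incseq_SucD)
      then show ?thesis
        using t0[of "Suc t" k] step.hyps(1) that(1) \<beta>(1) by (simp add: abs_mult mult_left_mono)
    qed
    ultimately have "\<bar>y k (Suc t)\<bar> \<le> (1 - ?a) * ?c + ?a * ?c + (m (Suc t) - m t) * (\<beta> + \<epsilon>)"
      unfolding eq by linarith
    then show ?case by (simp add: algebra_simps)
  qed
  have x: "\<bar>x k t\<bar> \<le> L + (\<beta> + 2 * \<epsilon>) * m t" if "k \<in> I" "t \<ge> t0" for k t
    using y[OF that] mD[OF that] by (simp add: y_def algebra_simps)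
  define U where "U = max (m t0) (L / (1 - \<beta> - 2 * \<epsilon>))"
  have U: "m t \<le> U" if "t \<ge> t0" for t
    using that
  proof (induction t rule: dec_induct)
    case (step t)
    from m(4)[of t] show ?case
    proof
      \<comment> \<open>A new maximum is the size of a current error, so the bound \<open>x\<close>
        applies to \<open>m\<close> itself, with a coefficient below 1.\<close>
      assume "\<exists>k\<in>I. m (Suc t) \<le> \<bar>x k (Suc t)\<bar>"
      then have "m (Suc t) \<le> L + (\<beta> + 2 * \<epsilon>) * m (Suc t)"
        using x[of _ "Suc t"] step.hyps(1) by force
      then have "m (Suc t) \<le> L / (1 - \<beta> - 2 * \<epsilon>)"
        using \<epsilon>(2) by (simp add: field_simps)
      then show ?thesis by (simp add: U_def)
    qed (use step.IH in simp)
  qed (simp add: U_def)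
  have "m t \<le> U" for t
    using U[of "max t t0"] m(1) incseqD[of m t "max t t0"] by auto
  then show ?thesis by blast
qed

text \<open>\<open>g\<close> serves the proof of boundedness, \<open>g_tail\<close> the improvement
  of asymptotic bounds. An eventual bound is the right form because of delays: a bound that holds
  for the errors from some time on reaches \<open>g\<close> only after the length of the
  delay.\<close>

theorem async_contraction_converges:
  fixes x g v a :: "'k \<Rightarrow> nat \<Rightarrow> real" and m :: "nat \<Rightarrow> real"
  assumes I: "finite I" and \<beta>: "0 \<le> \<beta>" "\<beta> < 1"
    and a: "\<And>k t. k \<in> I \<Longrightarrow> 0 \<le> a k t \<and> a k t \<le> 1"
    and div: "\<And>k. k \<in> I \<Longrightarrow> filterlim (\<lambda>n. \<Sum>t<n. a k t) at_top sequentially"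
    and rec: "\<And>k t. k \<in> I \<Longrightarrow> x k (Suc t) = (1 - a k t) * x k t + a k t * (g k t + m t * v k t)"
    and g: "\<And>k t. k \<in> I \<Longrightarrow> \<bar>g k t\<bar> \<le> \<beta> * m t"
    and g_tail: "\<And>k A. k \<in> I \<Longrightarrow> (\<And>l. l \<in> I \<Longrightarrow> eventually (\<lambda>t. \<bar>x l t\<bar> \<le> A) sequentially) \<Longrightarrow>
      eventually (\<lambda>t. \<bar>g k t\<bar> \<le> \<beta> * A) sequentially"
    and m: "incseq m" "\<And>t. 0 \<le> m t" "\<And>k t. k \<in> I \<Longrightarrow> \<bar>x k t\<bar> \<le> m t"
      "\<And>t. m (Suc t) \<le> m t \<or> (\<exists>k\<in>I. m (Suc t) \<le> \<bar>x k (Suc t)\<bar>)"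
    and conv: "\<And>k. k \<in> I \<Longrightarrow> convergent (\<lambda>n. \<Sum>t<n. a k t * v k t)"
    and k: "k \<in> I"
  shows "x k \<longlonglongrightarrow> 0"
proof -
  obtain U where U: "\<And>t. m t \<le> U"
    using async_contraction_bounded[where I=I and x=x and g=g and v=v and a=a and m=m, OF I \<beta> a rec g m conv] by blast
  \<comment> \<open>Only now, with \<open>U\<close> at hand, may \<open>m\<close> be absorbed into
    the noise series; from here on the noise is the unscaled one.\<close>
  have cm: "convergent (\<lambda>n. \<Sum>t<n. m t * (a l t * v l t))" if "l \<in> I" for l
    by (rule convergent_sum_mult_monotone[OF conv[OF that] m(1) U])
  have "\<forall>l\<in>I. \<exists>D. (\<forall>n. D (Suc n) = D n + m n * (a l n * v l n)) \<and> D \<longlonglongrightarrow> 0"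
  proof (intro ballI)
    fix l assume "l \<in> I"
    with cm show "\<exists>D. (\<forall>n. D (Suc n) = D n + m n * (a l n * v l n)) \<and> D \<longlonglongrightarrow> 0"
      using convergent_sum_tail[of "\<lambda>n. m n * (a l n * v l n)"] by blast
  qed
  then obtain D where D: "\<And>l n. l \<in> I \<Longrightarrow> D l (Suc n) = D l n + m n * (a l n * v l n)"
    "\<And>l. l \<in> I \<Longrightarrow> D l \<longlonglongrightarrow> 0"
    by (auto dest!: bchoice)
  define \<rho> where "\<rho> = (1 + \<beta>) / 2"
  have \<rho>: "0 < \<rho>" "\<rho> < 1" using \<beta> by (auto simp: \<rho>_def)
  have shrink: "eventually (\<lambda>t. \<bar>x l t\<bar> \<le> \<rho> * A) sequentially"
    if A: "A > 0" and ev: "\<And>l. l \<in> I \<Longrightarrow> eventually (\<lambda>t. \<bar>x l t\<bar> \<le> A) sequentially" and l: "l \<in> I" for A l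
  proof -
    \<comment> \<open>Three amounts \<open>\<delta>\<close> are lost: to \<open>D\<close> in the
      target, to the residual excess \<open>h\<close>, and to the return from \<open>y\<close> to
      \<open>x\<close>. They fit because \<open>\<rho> - \<beta>\<close> is half of
      \<open>1 - \<beta>\<close> and \<open>3 / 8 \<le> 1 / 2\<close>.\<close>
    define \<delta> where "\<delta> = (1 - \<beta>) / 8 * A"
    have \<delta>: "\<delta> > 0" using \<beta> A by (simp add: \<delta>_def)
    have evD: "eventually (\<lambda>t. \<bar>D l t\<bar> < \<delta>) sequentially"
      using D(2)[OF l] \<delta> by (simp add: tendsto_iff dist_real_def)
    have "eventually (\<lambda>t. \<bar>g l t\<bar> \<le> \<beta> * A) sequentially" using g_tail[OF l ev] by blast
    from eventually_conj[OF evD this] obtain t0 where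
      t0: "\<And>t. t \<ge> t0 \<Longrightarrow> \<bar>D l t\<bar> < \<delta> \<and> \<bar>g l t\<bar> \<le> \<beta> * A"
      by (auto simp: eventually_sequentially)
    define y where "y t = x l t - D l t" for t
    \<comment> \<open>Measuring the excess over the level \<open>\<beta> * A + \<delta>\<close>
      makes the averaging recursion homogeneous, as \<open>relaxation_tendsto_0\<close> requires;
      the cut-off at 0 keeps it nonnegative.\<close>
    define h where "h t = max 0 (\<bar>y t\<bar> - (\<beta> * A + \<delta>))" for t
    have "h \<longlonglongrightarrow> 0"
    proof (rule relaxation_tendsto_0[where a="a l" and T=t0])
      fix t assume t: "t \<ge> t0"
      let ?a = "a l t" and ?c = "\<beta> * A + \<delta>"
      have eq: "y (Suc t) = (1 - ?a) * y t + ?a * (g l t - D l t)"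
        using rec[OF l, of t] D(1)[OF l, of t] by (simp add: y_def algebra_simps)
      have a': "0 \<le> ?a" "0 \<le> 1 - ?a" using a[OF l] by auto
      have "\<bar>g l t - D l t\<bar> \<le> ?c" using t0[OF t] by linarith
      then have "\<bar>?a * (g l t - D l t)\<bar> \<le> ?a * ?c"
        using a' by (simp add: abs_mult mult_left_mono)
      moreover have "\<bar>(1 - ?a) * y t\<bar> = (1 - ?a) * \<bar>y t\<bar>" using a' by (simp add: abs_mult)
      ultimately have "\<bar>y (Suc t)\<bar> \<le> (1 - ?a) * \<bar>y t\<bar> + ?a * ?c" unfolding eq by linarith
      then have "\<bar>y (Suc t)\<bar> - ?c \<le> (1 - ?a) * (\<bar>y t\<bar> - ?c)" by (simp add: algebra_simps)
      also have "\<dots> \<le> (1 - ?a) * h t" using a' by (intro mult_left_mono) (auto simp: h_def)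
      finally have "\<bar>y (Suc t)\<bar> - ?c \<le> (1 - ?a) * h t" .
      moreover have "0 \<le> (1 - ?a) * h t" using a' by (simp add: h_def)
      ultimately show "h (Suc t) \<le> (1 - ?a) * h t" by (subst h_def) simp
    qed (use a[OF l] div[OF l] in \<open>auto simp: h_def\<close>)
    then have "eventually (\<lambda>t. \<bar>h t\<bar> < \<delta>) sequentially"
      using \<delta> by (simp add: tendsto_iff dist_real_def)
    with evD show ?thesis
    proof eventually_elim
      case (elim t)
      have "\<bar>y t\<bar> - (\<beta> * A + \<delta>) \<le> h t" by (simp add: h_def)
      then have "\<bar>x l t\<bar> \<le> \<beta> * A + 3 * \<delta>"
        using elim unfolding y_def by linarith
      also have "\<dots> \<le> \<rho> * A"
        using \<delta> by (simp add: \<rho>_def \<delta>_def field_simps)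
      finally show ?case .
    qed
  qed
  define A where "A = max 1 U"
  have "\<bar>x l t\<bar> \<le> A" if "l \<in> I" for l t
    using m(3)[OF that, of t] U[of t] by (simp add: A_def)
  then have iter: "l \<in> I \<Longrightarrow> eventually (\<lambda>t. \<bar>x l t\<bar> \<le> \<rho> ^ n * A) sequentially" for n l
  proof (induction n arbitrary: l)
    case (Suc n)
    have "0 < \<rho> ^ n * A" using \<rho> by (simp add: A_def)
    from shrink[OF this Suc.IH Suc.prems(1)] Suc.prems(2) show ?case by (simp add: mult.assoc)
  qed simp
  show ?thesis
  proof (rule tendstoI)
    fix e :: real assume "e > 0"
    have "(\<lambda>n. \<rho> ^ n * A) \<longlonglongrightarrow> 0 * A" using \<rho> by (intro tendsto_mult LIMSEQ_power_zero tendsto_const) auto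
    then have "eventually (\<lambda>n. \<rho> ^ n * A < e) sequentially"
      using \<open>e > 0\<close> by (simp add: order_tendstoD)
    then obtain n where "\<rho> ^ n * A < e" by (auto simp: eventually_sequentially)
    then show "eventually (\<lambda>t. dist (x k t) 0 < e) sequentially"
      using iter[OF k, of n] by (auto elim!: eventually_mono)
  qed
qed

section \<open>Martingale transforms\<close>

text \<open>Independence of the past replaces the usual vanishing conditional mean, so that moments
  factor without conditional expectations. Testing against real variables \<open>Z\<close> suffices:
  the computations use only a coefficient, or a coefficient times the sum so far.\<close>

locale innovations = prob_space M for M :: "'w measure" +
  fixes F :: "nat \<Rightarrow> 'w measure" and u :: "nat \<Rightarrow> 'w \<Rightarrow> real"
  assumes filtration: "filtration (space M) F"
    and subalgebra: "\<And>t. subalgebra M (F t)"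
    and adapted: "\<And>t. u t \<in> borel_measurable (F (Suc t))"
    and square_integrable: "\<And>t. integrable M (\<lambda>\<omega>. (u t \<omega>)\<^sup>2)"
    and centred: "\<And>t. expectation (u t) = 0"
    and indep: "\<And>t Z. Z \<in> borel_measurable (F t) \<Longrightarrow> indep_var borel Z borel (u t)"
begin

lemma sets_F_le: "s \<le> t \<Longrightarrow> sets (F s) \<subseteq> sets (F t)"
  using filtration by (simp add: filtration.sets_F_mono)

lemma space_F: "space (F t) = space M"
  using filtration by (simp add: filtration.space_F)

lemma measurable_F_le: "Z \<in> measurable (F s) N \<Longrightarrow> s \<le> t \<Longrightarrow> Z \<in> measurable (F t) N"
  using sets_F_le[of s t] space_F[of s] space_F[of t] unfolding measurable_def by auto

lemma measurable_F: "Z \<in> measurable (F t) N \<Longrightarrow> Z \<in> measurable M N"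
  using subalgebra by (rule measurable_from_subalg)

lemma integrable_mult_of_squares:
  assumes "f \<in> borel_measurable M" "g \<in> borel_measurable M"
    and "integrable M (\<lambda>\<omega>. (f \<omega> :: real)\<^sup>2)" "integrable M (\<lambda>\<omega>. (g \<omega> :: real)\<^sup>2)"
  shows "integrable M (\<lambda>\<omega>. f \<omega> * g \<omega>)"
proof (rule Bochner_Integration.integrable_bound[OF Bochner_Integration.integrable_add[OF assms(3,4)]])
  have "norm (f \<omega> * g \<omega>) \<le> norm ((f \<omega>)\<^sup>2 + (g \<omega>)\<^sup>2)" for \<omega>
  proof -
    have "0 \<le> \<bar>f \<omega>\<bar> * \<bar>g \<omega>\<bar>" by simp
    moreover have "2 * \<bar>f \<omega>\<bar> * \<bar>g \<omega>\<bar> \<le> (f \<omega>)\<^sup>2 + (g \<omega>)\<^sup>2"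
      using sum_squares_bound[of "\<bar>f \<omega>\<bar>" "\<bar>g \<omega>\<bar>"] by simp
    ultimately show ?thesis unfolding real_norm_def abs_mult by linarith
  qed
  then show "AE \<omega> in M. norm (f \<omega> * g \<omega>) \<le> norm ((f \<omega>)\<^sup>2 + (g \<omega>)\<^sup>2)" by simp
qed (use assms(1,2) in measurable)

lemma integrable_u: "integrable M (u t)"
  by (rule square_integrable_imp_integrable[OF measurable_F[OF adapted] square_integrable])

text \<open>Orthogonality of martingale differences: the sum so far times \<open>c n\<close> is
  known at time \<open>n\<close>, hence independent of the centred \<open>u n\<close>, and every
  mixed term integrates to 0. The diagonal terms factor because \<open>c n\<close> is
  predictable.\<close>

lemma
  assumes c: "\<And>t. c t \<in> borel_measurable (F t)" "\<And>t. integrable M (\<lambda>\<omega>. (c t \<omega>)\<^sup>2)"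
  shows integrable_transform_square: "integrable M (\<lambda>\<omega>. (\<Sum>t<n. c t \<omega> * u t \<omega>)\<^sup>2)"
    and expectation_transform_square:
      "expectation (\<lambda>\<omega>. (\<Sum>t<n. c t \<omega> * u t \<omega>)\<^sup>2) =
        (\<Sum>t<n. expectation (\<lambda>\<omega>. (c t \<omega>)\<^sup>2) * expectation (\<lambda>\<omega>. (u t \<omega>)\<^sup>2))"
proof -
  define T where "T n \<omega> = (\<Sum>t<n. c t \<omega> * u t \<omega>)" for n \<omega>
  have T_meas: "T n \<in> borel_measurable (F n)" for n
    unfolding T_def
  proof (intro borel_measurable_sum borel_measurable_times)
    fix t assume "t \<in> {..<n}"
    then show "c t \<in> borel_measurable (F n)" "u t \<in> borel_measurable (F n)"
      using measurable_F_le[OF c(1)] measurable_F_le[OF adapted] by auto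
  qed
  have "integrable M (\<lambda>\<omega>. (T n \<omega>)\<^sup>2) \<and> expectation (\<lambda>\<omega>. (T n \<omega>)\<^sup>2) =
        (\<Sum>t<n. expectation (\<lambda>\<omega>. (c t \<omega>)\<^sup>2) * expectation (\<lambda>\<omega>. (u t \<omega>)\<^sup>2))"
  proof (induction n)
    case 0
    then show ?case by (simp add: T_def)
  next
    case (Suc n)
    note [measurable] = measurable_F[OF c(1)] measurable_F[OF adapted] measurable_F[OF T_meas] c(1) T_meas
    have Z: "integrable M (\<lambda>\<omega>. T n \<omega> * c n \<omega>)"
      by (rule integrable_mult_of_squares) (use Suc c(2) in auto)
    have i1: "indep_var borel (\<lambda>\<omega>. T n \<omega> * c n \<omega>) borel (u n)"
      by (rule indep) measurable
    have i2: "indep_var borel (\<lambda>\<omega>. (c n \<omega>)\<^sup>2) borel (\<lambda>\<omega>. (u n \<omega>)\<^sup>2)"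
      using indep_var_compose[OF indep[OF c(1)], where ?Y1.0="\<lambda>x. x\<^sup>2" and ?Y2.0="\<lambda>x. x\<^sup>2" and ?N1.0=borel and ?N2.0=borel]
      by (simp add: o_def)
    have cross: "integrable M (\<lambda>\<omega>. T n \<omega> * c n \<omega> * u n \<omega>)"
      "expectation (\<lambda>\<omega>. T n \<omega> * c n \<omega> * u n \<omega>) = 0"
      using indep_var_integrable[OF i1 Z integrable_u] indep_var_lebesgue_integral[OF i1 Z integrable_u] centred
      by auto
    have sq: "integrable M (\<lambda>\<omega>. (c n \<omega>)\<^sup>2 * (u n \<omega>)\<^sup>2)"
      "expectation (\<lambda>\<omega>. (c n \<omega>)\<^sup>2 * (u n \<omega>)\<^sup>2) = expectation (\<lambda>\<omega>. (c n \<omega>)\<^sup>2) * expectation (\<lambda>\<omega>. (u n \<omega>)\<^sup>2)"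
      using indep_var_integrable[OF i2 c(2) square_integrable] indep_var_lebesgue_integral[OF i2 c(2) square_integrable]
      by auto
    have "(T (Suc n) \<omega>)\<^sup>2 = (T n \<omega>)\<^sup>2 + 2 * (T n \<omega> * c n \<omega> * u n \<omega>) + (c n \<omega>)\<^sup>2 * (u n \<omega>)\<^sup>2" for \<omega>
      by (simp add: T_def power2_eq_square algebra_simps)
    then show ?case using Suc cross sq by simp
  qed
  then show "integrable M (\<lambda>\<omega>. (\<Sum>t<n. c t \<omega> * u t \<omega>)\<^sup>2)"
    "expectation (\<lambda>\<omega>. (\<Sum>t<n. c t \<omega> * u t \<omega>)\<^sup>2) =
        (\<Sum>t<n. expectation (\<lambda>\<omega>. (c t \<omega>)\<^sup>2) * expectation (\<lambda>\<omega>. (u t \<omega>)\<^sup>2))"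
    by (simp_all add: T_def)
qed

text \<open>Kolmogorov's maximal inequality, for predictable random coefficients.\<close>

lemma transform_maximal_inequality:
  assumes c: "\<And>t. c t \<in> borel_measurable (F t)" "\<And>t. integrable M (\<lambda>\<omega>. (c t \<omega>)\<^sup>2)" and \<eta>: "\<eta> > 0"
  shows "prob {\<omega> \<in> space M. \<exists>n\<le>N. \<eta> \<le> \<bar>\<Sum>t<n. c t \<omega> * u t \<omega>\<bar>} \<le>
    (\<Sum>t<N. expectation (\<lambda>\<omega>. (c t \<omega>)\<^sup>2) * expectation (\<lambda>\<omega>. (u t \<omega>)\<^sup>2)) / \<eta>\<^sup>2"
proof -
  define S where "S n \<omega> = (\<Sum>t<n. c t \<omega> * u t \<omega>)" for n \<omega>
  \<comment> \<open>Freezing the sums at the first passage turns the maximal inequality into Chebyshev's.\<close>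
  define c' where "c' t \<omega> = (if \<forall>j\<le>t. \<bar>S j \<omega>\<bar> < \<eta> then c t \<omega> else 0)" for t \<omega>
  define T where "T \<omega> = (\<Sum>t<N. c' t \<omega> * u t \<omega>)" for \<omega>
  have S_meas: "S n \<in> borel_measurable (F t)" if "n \<le> t" for n t
    unfolding S_def
  proof (intro borel_measurable_sum borel_measurable_times)
    fix j assume "j \<in> {..<n}"
    then show "c j \<in> borel_measurable (F t)" "u j \<in> borel_measurable (F t)"
      using that measurable_F_le[OF c(1)] measurable_F_le[OF adapted] by auto
  qed
  \<comment> \<open>\<open>S j\<close> with \<open>j \<le> t\<close> involves innovations strictly
    before time \<open>t\<close> only, so the decision to freeze is taken before \<open>u t\<close>
    is drawn and \<open>c'\<close> stays predictable.\<close>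
  have c'_meas: "c' t \<in> borel_measurable (F t)" for t
  proof -
    have "{\<omega> \<in> space (F t). \<bar>S j \<omega>\<bar> < \<eta>} \<in> sets (F t)" if "j \<le> t" for j
      using S_meas[OF that] by measurable
    then have "{\<omega> \<in> space (F t). \<forall>j\<in>{..t}. \<bar>S j \<omega>\<bar> < \<eta>} \<in> sets (F t)"
      by (intro sets.sets_Collect_finite_All') auto
    then have *: "Measurable.pred (F t) (\<lambda>\<omega>. \<forall>j\<le>t. \<bar>S j \<omega>\<bar> < \<eta>)"
      unfolding pred_def by (simp only: atMost_iff Ball_def)
    show ?thesis unfolding c'_def using * c(1)[of t] by measurable
  qed
  have c'_sq: "integrable M (\<lambda>\<omega>. (c' t \<omega>)\<^sup>2)" for t
  proof (rule Bochner_Integration.integrable_bound[OF c(2)[of t]])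
    show "(\<lambda>\<omega>. (c' t \<omega>)\<^sup>2) \<in> borel_measurable M"
      using measurable_F[OF c'_meas[of t]] by measurable
  qed (simp add: c'_def)
  note [measurable] = measurable_F[OF c'_meas] measurable_F[OF adapted]
  have [measurable]: "T \<in> borel_measurable M" unfolding T_def by measurable
  have TS: "\<eta>\<^sup>2 \<le> (T \<omega>)\<^sup>2" if n: "n \<le> N" "\<eta> \<le> \<bar>S n \<omega>\<bar>" for n \<omega>
  proof -
    define \<tau> where "\<tau> = (LEAST j. \<eta> \<le> \<bar>S j \<omega>\<bar>)"
    have \<tau>: "\<eta> \<le> \<bar>S \<tau> \<omega>\<bar>" "\<tau> \<le> N"
      using LeastI[of "\<lambda>j. \<eta> \<le> \<bar>S j \<omega>\<bar>", OF n(2)] Least_le[of "\<lambda>j. \<eta> \<le> \<bar>S j \<omega>\<bar>", OF n(2)] n(1)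
      by (auto simp: \<tau>_def)
    \<comment> \<open>So \<open>c'\<close> agrees with \<open>c\<close> before the first passage
      \<open>\<tau>\<close> and is 0 from then on: \<open>T\<close> is the sum stopped at
      \<open>\<tau>\<close>.\<close>
    have "(\<forall>j\<le>t. \<bar>S j \<omega>\<bar> < \<eta>) \<longleftrightarrow> t < \<tau>" for t
    proof
      assume *: "\<forall>j\<le>t. \<bar>S j \<omega>\<bar> < \<eta>"
      show "t < \<tau>"
      proof (rule ccontr)
        assume "\<not> t < \<tau>"
        then have "\<bar>S \<tau> \<omega>\<bar> < \<eta>" using * by simp
        then show False using \<tau>(1) by linarith
      qed
    next
      assume t: "t < \<tau>"
      show "\<forall>j\<le>t. \<bar>S j \<omega>\<bar> < \<eta>"
      proof (intro allI impI)
        fix j assume "j \<le> t"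
        then have "j < (LEAST j. \<eta> \<le> \<bar>S j \<omega>\<bar>)" using t by (simp add: \<tau>_def)
        from not_less_Least[OF this] show "\<bar>S j \<omega>\<bar> < \<eta>" by linarith
      qed
    qed
    then have "T \<omega> = (\<Sum>t<N. if t < \<tau> then c t \<omega> * u t \<omega> else 0)"
      unfolding T_def c'_def by (intro sum.cong) auto
    also have "\<dots> = S \<tau> \<omega>"
      unfolding S_def using \<tau>(2) by (intro sum.mono_neutral_cong_right) auto
    finally show ?thesis using \<tau>(1) \<eta> by (simp add: abs_le_square_iff[symmetric])
  qed
  have "prob {\<omega> \<in> space M. \<exists>n\<le>N. \<eta> \<le> \<bar>S n \<omega>\<bar>} \<le> prob {\<omega> \<in> space M. \<eta>\<^sup>2 \<le> (T \<omega>)\<^sup>2}"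
    using TS by (intro finite_measure_mono) auto
  also have "\<dots> \<le> expectation (\<lambda>\<omega>. (T \<omega>)\<^sup>2) / \<eta>\<^sup>2"
  proof (rule integral_Markov_inequality_measure[where A="space M"])
    show "integrable M (\<lambda>\<omega>. (T \<omega>)\<^sup>2)"
      unfolding T_def by (rule integrable_transform_square[where c=c', OF c'_meas c'_sq])
  qed (use \<eta> in auto)
  also have "expectation (\<lambda>\<omega>. (T \<omega>)\<^sup>2) =
      (\<Sum>t<N. expectation (\<lambda>\<omega>. (c' t \<omega>)\<^sup>2) * expectation (\<lambda>\<omega>. (u t \<omega>)\<^sup>2))"
    unfolding T_def by (rule expectation_transform_square[where c=c', OF c'_meas c'_sq])
  also have "\<dots> / \<eta>\<^sup>2 \<le> (\<Sum>t<N. expectation (\<lambda>\<omega>. (c t \<omega>)\<^sup>2) * expectation (\<lambda>\<omega>. (u t \<omega>)\<^sup>2)) / \<eta>\<^sup>2"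
  proof (intro divide_right_mono sum_mono mult_right_mono)
    show "expectation (\<lambda>\<omega>. (c' t \<omega>)\<^sup>2) \<le> expectation (\<lambda>\<omega>. (c t \<omega>)\<^sup>2)" for t
      by (rule integral_mono[OF c'_sq c(2)]) (simp add: c'_def)
  qed simp_all
  finally show ?thesis by (simp add: S_def)
qed

text \<open>The maximal inequality for sums restarted at \<open>m\<close> bounds the probability of
  a large oscillation after \<open>m\<close> by the tail of the convergent variance series. Hence
  almost every path is Cauchy.\<close>

theorem transform_converges:
  assumes c: "\<And>t. c t \<in> borel_measurable (F t)" "\<And>t. integrable M (\<lambda>\<omega>. (c t \<omega>)\<^sup>2)"
    and summable: "summable (\<lambda>t. expectation (\<lambda>\<omega>. (c t \<omega>)\<^sup>2) * expectation (\<lambda>\<omega>. (u t \<omega>)\<^sup>2))"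
  shows "AE \<omega> in M. convergent (\<lambda>n. \<Sum>t<n. c t \<omega> * u t \<omega>)"
proof -
  define S where "S n \<omega> = (\<Sum>t<n. c t \<omega> * u t \<omega>)" for n \<omega>
  define V where "V t = expectation (\<lambda>\<omega>. (c t \<omega>)\<^sup>2) * expectation (\<lambda>\<omega>. (u t \<omega>)\<^sup>2)" for t
  note [measurable] = measurable_F[OF c(1)] measurable_F[OF adapted]
  have [measurable]: "S n \<in> borel_measurable M" for n unfolding S_def by measurable
  have V: "0 \<le> V t" "summable V" for t using summable by (simp_all add: V_def[abs_def])
  define E where "E e m n = {\<omega> \<in> space M. \<exists>k\<le>n. e \<le> \<bar>S (m + k) \<omega> - S m \<omega>\<bar>}" for e m n
  have E_sets [measurable]: "E e m n \<in> sets M" for e m n unfolding E_def by measurable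
  have bound: "prob (E e m n) \<le> (\<Sum>t. V (t + m)) / e\<^sup>2" if "e > 0" for e m n
  proof -
    \<comment> \<open>Setting the coefficients before \<open>m\<close> to 0 restarts the sums at
      \<open>m\<close> and keeps the coefficients predictable.\<close>
    define c' where "c' t \<omega> = (if m \<le> t then c t \<omega> else 0)" for t \<omega>
    have c': "c' t \<in> borel_measurable (F t)" "integrable M (\<lambda>\<omega>. (c' t \<omega>)\<^sup>2)" for t
      using c by (cases "m \<le> t"; simp add: c'_def[abs_def])+
    note [measurable] = measurable_F[OF c'(1)]
    have S': "(\<Sum>t<m+k. c' t \<omega> * u t \<omega>) = S (m + k) \<omega> - S m \<omega>" for k \<omega>
    proof (induction k)
      case 0
      have "(\<Sum>t<m. c' t \<omega> * u t \<omega>) = 0" by (intro sum.neutral) (auto simp: c'_def)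
      then show ?case by simp
    qed (simp add: S_def c'_def)
    have "E e m n \<subseteq> {\<omega> \<in> space M. \<exists>k\<le>m+n. e \<le> \<bar>\<Sum>t<k. c' t \<omega> * u t \<omega>\<bar>}"
    proof (auto simp: E_def)
      fix \<omega> k assume "k \<le> n" "e \<le> \<bar>S (m + k) \<omega> - S m \<omega>\<bar>"
      then show "\<exists>k\<le>m + n. e \<le> \<bar>\<Sum>t<k. c' t \<omega> * u t \<omega>\<bar>"
        using S'[of \<omega> k] by (intro exI[of _ "m + k"]) auto
    qed
    then have "prob (E e m n) \<le> prob {\<omega> \<in> space M. \<exists>k\<le>m+n. e \<le> \<bar>\<Sum>t<k. c' t \<omega> * u t \<omega>\<bar>}"
      by (rule finite_measure_mono) measurable
    also have "\<dots> \<le> (\<Sum>t<m+n. expectation (\<lambda>\<omega>. (c' t \<omega>)\<^sup>2) * expectation (\<lambda>\<omega>. (u t \<omega>)\<^sup>2)) / e\<^sup>2"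
      by (rule transform_maximal_inequality[OF c' that])
    also have "(\<Sum>t<m+n. expectation (\<lambda>\<omega>. (c' t \<omega>)\<^sup>2) * expectation (\<lambda>\<omega>. (u t \<omega>)\<^sup>2)) =
        (\<Sum>t<n. V (t + m))"
    proof -
      have "(\<Sum>t<m+n. expectation (\<lambda>\<omega>. (c' t \<omega>)\<^sup>2) * expectation (\<lambda>\<omega>. (u t \<omega>)\<^sup>2)) =
          (\<Sum>t\<in>{m..<m+n}. V t)"
        by (intro sum.mono_neutral_cong_right) (auto simp: c'_def V_def)
      then show ?thesis using sum.shift_bounds_nat_ivl[of V 0 m n] by (simp add: add.commute atLeast0LessThan)
    qed
    also have "(\<Sum>t<n. V (t + m)) / e\<^sup>2 \<le> (\<Sum>t. V (t + m)) / e\<^sup>2"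
      using V by (intro divide_right_mono sum_le_suminf) (auto simp: summable_iff_shift)
    finally show ?thesis .
  qed
  have null: "AE \<omega> in M. \<exists>m. \<forall>n. \<omega> \<notin> E e m n" if e: "e > 0" for e
  proof -
    \<comment> \<open>The paths that still move by \<open>e\<close> after every time
      \<open>m\<close>. The bound on \<open>E e m n\<close> is uniform in the horizon
      \<open>n\<close>, so it survives the increasing union; then \<open>m\<close> tends to
      infinity.\<close>
    let ?Z = "\<Inter>m. \<Union>n. E e m n"
    have Zm: "prob ?Z \<le> (\<Sum>t. V (t + m)) / e\<^sup>2" for m
    proof -
      have "incseq (E e m)" by (intro incseq_SucI) (auto simp: E_def intro: le_SucI)
      then have "(\<lambda>n. prob (E e m n)) \<longlonglongrightarrow> prob (\<Union>n. E e m n)"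
        by (intro finite_Lim_measure_incseq) auto
      then have "prob (\<Union>n. E e m n) \<le> (\<Sum>t. V (t + m)) / e\<^sup>2"
        using bound[OF e] by (intro LIMSEQ_le_const2) auto
      moreover have "prob ?Z \<le> prob (\<Union>n. E e m n)" by (intro finite_measure_mono) auto
      ultimately show ?thesis by simp
    qed
    have "(\<lambda>m. (\<Sum>t. V (t + m)) / e\<^sup>2) \<longlonglongrightarrow> 0 / e\<^sup>2"
      by (intro tendsto_divide suminf_exist_split2 tendsto_const) (use V e in auto)
    then have "prob ?Z \<le> 0" using Zm by (intro LIMSEQ_le_const[of _ 0]) auto
    then have "prob ?Z = 0" using measure_nonneg[of M ?Z] by linarith
    then have "AE \<omega> in M. \<omega> \<notin> ?Z" by (intro AE_not_in null_setsI) (auto simp: emeasure_eq_measure)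
    then show ?thesis by eventually_elim auto
  qed
  \<comment> \<open>Countably many tolerances suffice for the Cauchy property and keep the
    exceptional set null.\<close>
  have "AE \<omega> in M. \<forall>j. \<exists>m. \<forall>n. \<omega> \<notin> E (inverse (real (Suc j))) m n"
    by (subst AE_all_countable) (auto intro: null)
  with AE_space show ?thesis
  proof eventually_elim
    case (elim \<omega>)
    have "Cauchy (\<lambda>n. S n \<omega>)"
    proof (rule CauchyI')
      fix e :: real assume "e > 0"
      then obtain j where j: "inverse (real (Suc j)) < e / 2" using reals_Archimedean[of "e / 2"] by auto
      obtain m where m: "\<And>n. \<omega> \<notin> E (inverse (real (Suc j))) m n" using elim by blast
      have *: "\<bar>S n \<omega> - S m \<omega>\<bar> < e / 2" if "n \<ge> m" for n
        using m[of "n - m"] that j elim(1) by (auto simp: E_def not_le dest!: spec[of _ "n - m"])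
      have "dist (S p \<omega>) (S n \<omega>) < e" if "p \<ge> m" "n > p" for p n
        using *[of p] *[of n] that unfolding dist_real_def by linarith
      then show "\<exists>m. \<forall>p\<ge>m. \<forall>n>p. dist (S p \<omega>) (S n \<omega>) < e" by blast
    qed
    then show ?case by (simp add: S_def Cauchy_convergent_iff)
  qed
qed

end

section \<open>Weighted contractions and the Bellman equation\<close>

abbreviation policy_average :: "('s \<Rightarrow> 'a \<Rightarrow> 's::finite pmf) \<Rightarrow> ('s \<Rightarrow> 'a) \<Rightarrow> ('s \<Rightarrow> real) \<Rightarrow> 's \<Rightarrow> real" where
  "policy_average p \<pi> g s \<equiv> \<Sum>s'\<in>UNIV. pmf (p s (\<pi> s)) s' * g s'"

lemma finite_type_maximizer:
  fixes h :: "'b::finite \<Rightarrow> real"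
  shows "\<exists>x. \<forall>y. h y \<le> h x"
proof -
  have "Max (range h) \<in> range h" by (intro Max_in) auto
  then obtain x where "h x = Max (range h)" by (metis imageE)
  then show ?thesis by (intro exI[of _ x]) simp
qed

lemma finite_set_pmf_trajectory:
  fixes p :: "'s::finite \<Rightarrow> 'a \<Rightarrow> 's pmf"
  shows "finite (set_pmf (trajectory p \<pi> s T))"
  by (induction T) auto

lemma length_trajectory: "xs \<in> set_pmf (trajectory p \<pi> s T) \<Longrightarrow> length xs = Suc T"
  by (induction T arbitrary: xs) auto

lemma expectation_pmf_finite:
  fixes p :: "'s::finite pmf" and g :: "'s \<Rightarrow> real"
  shows "measure_pmf.expectation p g = (\<Sum>s'\<in>UNIV. pmf p s' * g s')"
  by (subst integral_measure_pmf_real[where A=UNIV]) (auto simp: mult.commute)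

text \<open>The induction is general in \<open>g\<close> because the last transition averages
  \<open>g\<close> first: the case \<open>t = Suc T\<close> is the induction hypothesis for
  \<open>policy_average p \<pi> g\<close>. For \<open>t \<le> T\<close>, appending a state leaves
  entry \<open>t\<close> unchanged.\<close>

lemma expectation_trajectory:
  fixes p :: "'s::finite \<Rightarrow> 'a \<Rightarrow> 's pmf"
  shows "t \<le> T \<Longrightarrow> measure_pmf.expectation (trajectory p \<pi> s T) (\<lambda>xs. g (xs ! t)) = (policy_average p \<pi> ^^ t) g s"
proof (induction T arbitrary: t g)
  case 0
  then show ?case by simp
next
  case (Suc T)
  let ?A = "set_pmf (trajectory p \<pi> s T)"
  let ?k = "\<lambda>xs. map_pmf (\<lambda>s'. xs @ [s']) (p (last xs) (\<pi> (last xs)))"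
  have E: "(\<Sum>xs\<in>?A. pmf (trajectory p \<pi> s T) xs * h xs) = measure_pmf.expectation (trajectory p \<pi> s T) h" for h :: "'s list \<Rightarrow> real"
    by (subst integral_measure_pmf_real[where A="?A"]) (auto simp: finite_set_pmf_trajectory mult.commute)
  have "measure_pmf.expectation (trajectory p \<pi> s (Suc T)) (\<lambda>xs. g (xs ! t)) =
    (\<Sum>xs\<in>?A. pmf (trajectory p \<pi> s T) xs *\<^sub>R measure_pmf.expectation (?k xs) (\<lambda>xs. g (xs ! t)))"
    unfolding trajectory.simps by (rule pmf_expectation_bind) (auto simp: finite_set_pmf_trajectory)
  also have "\<dots> = (policy_average p \<pi> ^^ t) g s"
  proof (cases "t \<le> T")
    case True
    then have "measure_pmf.expectation (?k xs) (\<lambda>xs. g (xs ! t)) = g (xs ! t)" if "xs \<in> ?A" for xs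
      using length_trajectory[OF that] by (simp add: nth_append)
    then have "(\<Sum>xs\<in>?A. pmf (trajectory p \<pi> s T) xs *\<^sub>R measure_pmf.expectation (?k xs) (\<lambda>xs. g (xs ! t))) =
      (\<Sum>xs\<in>?A. pmf (trajectory p \<pi> s T) xs * g (xs ! t))"
      by (intro sum.cong) auto
    then show ?thesis using Suc.IH[OF True] by (simp add: E)
  next
    case False
    then have t: "t = Suc T" using Suc.prems by simp
    have "measure_pmf.expectation (?k xs) (\<lambda>xs. g (xs ! t)) = policy_average p \<pi> g (xs ! T)" if "xs \<in> ?A" for xs
      using length_trajectory[OF that] last_conv_nth[of xs] by (force simp: nth_append t expectation_pmf_finite)
    then have "(\<Sum>xs\<in>?A. pmf (trajectory p \<pi> s T) xs *\<^sub>R measure_pmf.expectation (?k xs) (\<lambda>xs. g (xs ! t))) =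
      (\<Sum>xs\<in>?A. pmf (trajectory p \<pi> s T) xs * policy_average p \<pi> g (xs ! T))"
      by (intro sum.cong) auto
    then show ?thesis using Suc.IH[of T "policy_average p \<pi> g"] by (simp add: E t funpow_Suc_right del: funpow.simps)
  qed
  finally show ?case .
qed

lemma expected_return_eq:
  fixes R :: "'s::finite \<Rightarrow> 'a::finite \<Rightarrow> real measure"
  assumes R: "\<And>s a. real_distribution (R s a)" and int: "\<And>s a. integrable (R s a) (\<lambda>x. x)"
  shows "expected_return R p \<gamma> \<pi> s T =
    (\<Sum>t\<le>T. \<gamma> ^ t * (policy_average p \<pi> ^^ t) (\<lambda>s. \<integral>x. x \<partial>R s (\<pi> s)) s)"
proof -
  define I where "I = {..T} \<times> (UNIV :: 's set) \<times> (UNIV :: 'a set)"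
  define D where "D = (\<Pi>\<^sub>M k\<in>I. R (fst (snd k)) (snd (snd k)))"
  define J where "J = measure_pmf (trajectory p \<pi> s T)"
  have Rk: "prob_space (R (fst (snd k)) (snd (snd k)))" for k :: "nat \<times> 's \<times> 'a"
    using R by (simp add: real_distribution_def)
  have sets_R [measurable_cong]: "sets (R s a) = sets borel" for s a
    using R by (simp add: real_distribution_def real_distribution_axioms_def)
  interpret D: prob_space D unfolding D_def by (rule prob_space_PiM) (rule Rk)
  interpret J: prob_space J unfolding J_def by (rule measure_pmf.prob_space_axioms)
  interpret JD: pair_sigma_finite J D ..
  have J_int: "integrable J g" for g :: "'s list \<Rightarrow> real"
    unfolding J_def by (rule integrable_measure_pmf_finite[OF finite_set_pmf_trajectory])
  have comp: "integrable D (\<lambda>y. y (t, s', a))" "(\<integral>y. y (t, s', a) \<partial>D) = (\<integral>x. x \<partial>R s' a)"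
    if "t \<le> T" for t s' a
  proof -
    let ?k = "(t, s', a)"
    have k: "?k \<in> I" using that by (simp add: I_def)
    have "distr D (R s' a) (\<lambda>y. y ?k) = R s' a"
      using distr_PiM_component[of I "\<lambda>k. R (fst (snd k)) (snd (snd k))" ?k, OF Rk k] by (simp add: D_def)
    moreover have m: "(\<lambda>y. y ?k) \<in> measurable D (R s' a)"
      using measurable_component_singleton[OF k, of "\<lambda>k. R (fst (snd k)) (snd (snd k))"] by (simp add: D_def)
    ultimately show "integrable D (\<lambda>y. y ?k)" "(\<integral>y. y ?k \<partial>D) = (\<integral>x. x \<partial>R s' a)"
      using integrable_distr[OF m, of "\<lambda>x. x"] integral_distr[OF m, of "\<lambda>x. x"] int[of s' a] sets_R[of s' a]
      by (simp_all add: measurable_def[of _ borel] sets_eq_imp_space_eq[OF sets_R])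
  qed
  \<comment> \<open>The reward is read from the table at a random index. Splitting by the visited
    state \<open>s'\<close> fixes the index: each summand is an indicator on the trajectory times a
    fixed coordinate of the table, and Fubini separates the two.\<close>
  define h where "h t s' z = indicator {xs. xs ! t = s'} (fst z) * snd z (t, s', \<pi> s')" for t s' and z :: "'s list \<times> (nat \<times> 's \<times> 'a \<Rightarrow> real)"
  have h_integral: "integrable (J \<Otimes>\<^sub>M D) (h t s')"
    "integral\<^sup>L (J \<Otimes>\<^sub>M D) (h t s') =
      (\<integral>xs. indicator {xs. xs ! t = s'} xs * (\<integral>x. x \<partial>R s' (\<pi> s')) \<partial>J)" if t: "t \<le> T" for t s'
  proof -
    have [measurable]: "(\<lambda>y. y (t, s', \<pi> s')) \<in> borel_measurable D" using comp(1)[OF t] by simp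
    have [measurable]: "{xs. xs ! t = s'} \<in> sets J" by (simp add: J_def)
    have [measurable]: "h t s' \<in> borel_measurable (J \<Otimes>\<^sub>M D)" unfolding h_def by measurable
    have 1: "integrable D (\<lambda>y. h t s' (xs, y))" for xs
      using comp(1)[OF t] by (simp add: h_def)
    show int': "integrable (J \<Otimes>\<^sub>M D) (h t s')"
      by (rule JD.Fubini_integrable) (auto simp: 1 J_int)
    show "integral\<^sup>L (J \<Otimes>\<^sub>M D) (h t s') =
      (\<integral>xs. indicator {xs. xs ! t = s'} xs * (\<integral>x. x \<partial>R s' (\<pi> s')) \<partial>J)"
      using comp(2)[OF t] by (subst JD.integral_fst'[OF int', symmetric]) (simp add: h_def)
  qed
  have "expected_return R p \<gamma> \<pi> s T =
    (\<integral>z. (\<Sum>t\<le>T. \<gamma> ^ t * (\<Sum>s'\<in>UNIV. h t s' z)) \<partial>(J \<Otimes>\<^sub>M D))"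
    unfolding expected_return_def I_def[symmetric] D_def[symmetric] J_def[symmetric]
  proof (intro Bochner_Integration.integral_cong refl sum.cong arg_cong2[of _ _ _ _ "(*)"])
    fix z :: "'s list \<times> (nat \<times> 's \<times> 'a \<Rightarrow> real)" and t
    have "(\<Sum>s'\<in>UNIV. h t s' z) = (\<Sum>s'\<in>UNIV. if s' = fst z ! t then snd z (t, s', \<pi> s') else 0)"
      unfolding h_def by (intro sum.cong) auto
    then show "snd z (t, fst z ! t, \<pi> (fst z ! t)) = (\<Sum>s'\<in>UNIV. h t s' z)" by simp
  qed
  also have "\<dots> = (\<Sum>t\<le>T. \<gamma> ^ t * (\<Sum>s'\<in>UNIV. integral\<^sup>L (J \<Otimes>\<^sub>M D) (h t s')))"
    using h_integral(1) by (subst Bochner_Integration.integral_sum) (auto simp: Bochner_Integration.integral_sum)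
  also have "\<dots> = (\<Sum>t\<le>T. \<gamma> ^ t * (policy_average p \<pi> ^^ t) (\<lambda>s. \<integral>x. x \<partial>R s (\<pi> s)) s)"
  proof (intro sum.cong refl arg_cong2[of _ _ _ _ "(*)"])
    fix t assume "t \<in> {..T}"
    then have t: "t \<le> T" by simp
    have "(\<Sum>s'\<in>UNIV. integral\<^sup>L (J \<Otimes>\<^sub>M D) (h t s')) =
      (\<Sum>s'\<in>UNIV. \<integral>xs. indicator {xs. xs ! t = s'} xs * (\<integral>x. x \<partial>R s' (\<pi> s')) \<partial>J)"
      by (simp add: h_integral(2)[OF t])
    also have "\<dots> = (\<integral>xs. (\<Sum>s'\<in>UNIV. indicator {xs. xs ! t = s'} xs * (\<integral>x. x \<partial>R s' (\<pi> s'))) \<partial>J)"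
      by (subst Bochner_Integration.integral_sum)
        (auto simp: J_int)
    also have "\<dots> = (\<integral>xs. (\<integral>x. x \<partial>R (xs ! t) (\<pi> (xs ! t))) \<partial>J)"
    proof (intro Bochner_Integration.integral_cong refl)
      fix xs
      have "(\<Sum>s'\<in>UNIV. indicator {xs. xs ! t = s'} xs * (\<integral>x. x \<partial>R s' (\<pi> s'))) =
        (\<Sum>s'\<in>UNIV. if s' = xs ! t then (\<integral>x. x \<partial>R s' (\<pi> s')) else 0)"
        by (intro sum.cong) auto
      then show "(\<Sum>s'\<in>UNIV. indicator {xs. xs ! t = s'} xs * (\<integral>x. x \<partial>R s' (\<pi> s'))) = (\<integral>x. x \<partial>R (xs ! t) (\<pi> (xs ! t)))"
        by simp
    qed
    also have "\<dots> = (policy_average p \<pi> ^^ t) (\<lambda>s. \<integral>x. x \<partial>R s (\<pi> s)) s"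
      unfolding J_def by (rule expectation_trajectory[OF t])
    finally show "(\<Sum>s'\<in>UNIV. integral\<^sup>L (J \<Otimes>\<^sub>M D) (h t s')) = (policy_average p \<pi> ^^ t) (\<lambda>s. \<integral>x. x \<partial>R s (\<pi> s)) s" .
  qed
  finally show ?thesis .
qed

text \<open>
  The weights \<open>\<xi>\<close> may vanish: in the undiscounted case they do so exactly at the absorbing state.
\<close>

locale weighted_mdp =
  fixes R :: "'s::finite \<Rightarrow> 'a::finite \<Rightarrow> real measure" and p :: "'s \<Rightarrow> 'a \<Rightarrow> 's pmf"
    and \<gamma> \<beta> :: real and \<xi> :: "'s \<Rightarrow> real"
  assumes reward_law: "\<And>s a. real_distribution (R s a)"
    and reward_integrable: "\<And>s a. integrable (R s a) (\<lambda>x. x)"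
    and discount_nonneg: "0 \<le> \<gamma>"
    and \<beta>: "0 \<le> \<beta>" "\<beta> < 1"
    and weight_nonneg: "\<And>s. 0 \<le> \<xi> s"
    and contraction: "\<And>s a. \<gamma> * (\<Sum>s'\<in>UNIV. pmf (p s a) s' * \<xi> s') \<le> \<beta> * \<xi> s"
    and zero_weight_reward: "\<And>s a. \<xi> s = 0 \<Longrightarrow> (\<integral>x. x \<partial>R s a) = 0"
begin

lemma discounted_average_le:
  assumes "\<And>s'. g s' \<le> c * \<xi> s'" "0 \<le> c"
  shows "\<gamma> * (\<Sum>s'\<in>UNIV. pmf (p s a) s' * g s') \<le> c * \<beta> * \<xi> s"
proof -
  have "(\<Sum>s'\<in>UNIV. pmf (p s a) s' * g s') \<le> (\<Sum>s'\<in>UNIV. pmf (p s a) s' * (c * \<xi> s'))"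
    by (intro sum_mono mult_left_mono assms) auto
  then have "\<gamma> * (\<Sum>s'\<in>UNIV. pmf (p s a) s' * g s') \<le> \<gamma> * (\<Sum>s'\<in>UNIV. pmf (p s a) s' * (c * \<xi> s'))"
    using discount_nonneg by (rule mult_left_mono)
  also have "\<dots> = c * (\<gamma> * (\<Sum>s'\<in>UNIV. pmf (p s a) s' * \<xi> s'))"
    by (simp add: sum_distrib_left mult_ac)
  also have "\<dots> \<le> c * (\<beta> * \<xi> s)" using contraction assms(2) by (rule mult_left_mono)
  finally show ?thesis by (simp add: mult.assoc)
qed

lemma discounted_average_abs_le:
  assumes "\<And>s'. \<bar>g s'\<bar> \<le> c * \<xi> s'" "0 \<le> c"
  shows "\<bar>\<gamma> * (\<Sum>s'\<in>UNIV. pmf (p s a) s' * g s')\<bar> \<le> c * \<beta> * \<xi> s"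
proof -
  have "g s' \<le> c * \<xi> s'" "- g s' \<le> c * \<xi> s'" for s' using assms(1)[of s'] by auto
  from discounted_average_le[of g c s a, OF this(1) assms(2)]
    discounted_average_le[of "\<lambda>s. - g s" c s a, OF this(2) assms(2)]
  show ?thesis by (simp add: sum_negf abs_le_iff)
qed

lemma weighted_bound:
  fixes g :: "'s \<Rightarrow> real"
  assumes "\<And>s. \<xi> s = 0 \<Longrightarrow> g s = 0"
  obtains c where "0 \<le> c" "\<And>s. \<bar>g s\<bar> \<le> c * \<xi> s"
proof
  \<comment> \<open>The sum of the ratios replaces their maximum. Where \<open>\<xi> s = 0\<close>
    the ratio is a division by 0 and contributes 0.\<close>
  let ?c = "\<Sum>s\<in>UNIV. \<bar>g s\<bar> / \<xi> s"
  show "0 \<le> ?c" using weight_nonneg by (intro sum_nonneg) auto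
  show "\<bar>g s\<bar> \<le> ?c * \<xi> s" for s
  proof (cases "\<xi> s = 0")
    case False
    then have "\<xi> s > 0" using weight_nonneg[of s] by simp
    moreover have "\<bar>g s\<bar> / \<xi> s \<le> ?c"
      using weight_nonneg by (intro member_le_sum[of s UNIV "\<lambda>s. \<bar>g s\<bar> / \<xi> s"]) auto
    ultimately show ?thesis by (simp add: field_simps)
  qed (use assms in simp)
qed

text \<open>A minimum principle: iterating the inequality along the chain shrinks the weighted norm
  of the negative part of \<open>D\<close> by the factor \<open>\<beta>\<close> each time. The
  condition at weight 0 is the boundary condition; it makes this norm finite.\<close>

lemma superharmonic_nonneg:
  fixes D :: "'s \<Rightarrow> real"
  assumes zero: "\<And>s. \<xi> s = 0 \<Longrightarrow> D s = 0"
    and D: "\<And>s. \<gamma> * policy_average p \<pi> D s \<le> D s"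
  shows "0 \<le> D s"
proof -
  obtain c where c: "0 \<le> c" "\<And>s. \<bar>D s\<bar> \<le> c * \<xi> s" using weighted_bound[of D] zero by blast
  have bound: "- D s \<le> c * \<beta> ^ n * \<xi> s" for n s
  proof (induction n arbitrary: s)
    case 0
    then show ?case using c(2)[of s] by simp
  next
    case (Suc n)
    have "\<gamma> * policy_average p \<pi> (\<lambda>s. - D s) s \<le> c * \<beta> ^ n * \<beta> * \<xi> s"
      using Suc \<beta> c(1) by (intro discounted_average_le) auto
    then show ?case using D[of s] by (simp add: sum_negf mult_ac)
  qed
  have "(\<lambda>n. c * \<beta> ^ n * \<xi> s) \<longlonglongrightarrow> c * 0 * \<xi> s"
    using \<beta> by (intro tendsto_mult tendsto_const LIMSEQ_power_zero) auto
  then have "- D s \<le> c * 0 * \<xi> s"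
    using bound by (intro LIMSEQ_le_const) auto
  then show ?thesis by simp
qed

text \<open>The expected returns are partial sums of a series dominated by a geometric one in the
  weighted norm. So the \<open>lim\<close> in \<open>policy_value\<close> is a genuine limit even
  when \<open>\<gamma> = 1\<close>, and shifting the series by one index gives the fixed point
  equation.\<close>

lemma policy_value:
  shows policy_value_fixed_point:
      "policy_value R p \<gamma> \<pi> s = (\<integral>x. x \<partial>R s (\<pi> s)) + \<gamma> * policy_average p \<pi> (policy_value R p \<gamma> \<pi>) s"
    and policy_value_zero_weight: "\<xi> s = 0 \<Longrightarrow> policy_value R p \<gamma> \<pi> s = 0"
proof -
  define \<rho> where "\<rho> s = (\<integral>x. x \<partial>R s (\<pi> s))" for s
  define h where "h t s = \<gamma> ^ t * (policy_average p \<pi> ^^ t) \<rho> s" for t s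
  have h_Suc: "h (Suc t) s = \<gamma> * policy_average p \<pi> (h t) s" for t s
    by (simp add: h_def sum_distrib_left mult_ac)
  obtain c where c: "0 \<le> c" "\<And>s. \<bar>\<rho> s\<bar> \<le> c * \<xi> s"
    using weighted_bound[of \<rho>] zero_weight_reward by (auto simp: \<rho>_def)
  have bound: "\<bar>h t s\<bar> \<le> c * \<beta> ^ t * \<xi> s" for t s
  proof (induction t arbitrary: s)
    case 0
    then show ?case using c(2) by (simp add: h_def)
  next
    case (Suc t)
    then have "\<bar>\<gamma> * policy_average p \<pi> (h t) s\<bar> \<le> c * \<beta> ^ t * \<beta> * \<xi> s"
      using \<beta> c(1) by (intro discounted_average_abs_le) auto
    then show ?case by (simp add: h_Suc mult_ac)
  qed
  have summable: "summable (\<lambda>t. h t s)" for s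
  proof (rule summable_comparison_test')
    show "summable (\<lambda>t. c * \<beta> ^ t * \<xi> s)"
      using \<beta> by (intro summable_mult summable_mult2 summable_geometric) auto
  qed (use bound in auto)
  have "expected_return R p \<gamma> \<pi> s = (\<lambda>T. \<Sum>t\<le>T. h t s)" for s
    by (rule ext) (simp add: expected_return_eq[OF reward_law reward_integrable] h_def \<rho>_def[abs_def])
  then have val: "policy_value R p \<gamma> \<pi> s = (\<Sum>t. h t s)" for s
    using summable_LIMSEQ'[OF summable] by (simp add: policy_value_def limI)
  have "(\<Sum>t. h t s) = h 0 s + (\<Sum>t. h (Suc t) s)"
    using suminf_split_head[OF summable] by simp
  also have "(\<Sum>t. h (Suc t) s) = \<gamma> * policy_average p \<pi> (\<lambda>s. \<Sum>t. h t s) s"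
  proof -
    have "(\<Sum>t. policy_average p \<pi> (h t) s) = (\<Sum>s'\<in>UNIV. \<Sum>t. pmf (p s (\<pi> s)) s' * h t s')"
      by (rule suminf_sum) (intro summable_mult summable)
    then show ?thesis
      using summable by (simp add: h_Suc suminf_mult summable_mult summable_sum)
  qed
  finally show "policy_value R p \<gamma> \<pi> s = (\<integral>x. x \<partial>R s (\<pi> s)) + \<gamma> * policy_average p \<pi> (policy_value R p \<gamma> \<pi>) s"
    by (simp add: val h_def \<rho>_def)
  show "policy_value R p \<gamma> \<pi> s = 0" if "\<xi> s = 0"
    using bound[of _ s] that by (simp add: val)
qed

abbreviation "action_value v s a \<equiv> (\<integral>x. x \<partial>R s a) + \<gamma> * (\<Sum>s'\<in>UNIV. pmf (p s a) s' * v s')"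

lemma policy_value_ge:
  assumes zero: "\<And>s. \<xi> s = 0 \<Longrightarrow> v s = 0" and v: "\<And>s. v s \<le> action_value v s (\<pi> s)"
  shows "v s \<le> policy_value R p \<gamma> \<pi> s"
proof -
  have "0 \<le> policy_value R p \<gamma> \<pi> s - v s"
  proof (rule superharmonic_nonneg[where \<pi>=\<pi>])
    show "\<gamma> * policy_average p \<pi> (\<lambda>s. policy_value R p \<gamma> \<pi> s - v s) s \<le> policy_value R p \<gamma> \<pi> s - v s" for s
      using v[of s] policy_value_fixed_point[of \<pi> s] by (simp add: right_diff_distrib sum_subtractf)
  qed (use zero policy_value_zero_weight in simp)
  then show ?thesis by simp
qed

lemma policy_value_le:
  assumes zero: "\<And>s. \<xi> s = 0 \<Longrightarrow> v s = 0" and v: "\<And>s. action_value v s (\<pi> s) \<le> v s"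
  shows "policy_value R p \<gamma> \<pi> s \<le> v s"
proof -
  have "0 \<le> v s - policy_value R p \<gamma> \<pi> s"
  proof (rule superharmonic_nonneg[where \<pi>=\<pi>])
    show "\<gamma> * policy_average p \<pi> (\<lambda>s. v s - policy_value R p \<gamma> \<pi> s) s \<le> v s - policy_value R p \<gamma> \<pi> s" for s
      using v[of s] policy_value_fixed_point[of \<pi> s] by (simp add: right_diff_distrib sum_subtractf)
  qed (use zero policy_value_zero_weight in simp)
  then show ?thesis by simp
qed

text \<open>
  A policy maximizing the total value over all states satisfies the Bellman equation, because
  otherwise acting greedily with respect to its value would improve it.
\<close>

lemma bellman:
  shows optimal_value_bellman: "optimal_value R p \<gamma> s = (MAX a. optimal_action_value R p \<gamma> s a)"
    and optimal_value_zero_weight: "\<xi> s = 0 \<Longrightarrow> optimal_value R p \<gamma> s = 0"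
proof -
  let ?V = "policy_value R p \<gamma>"
  let ?tot = "\<lambda>\<pi>. \<Sum>s\<in>UNIV. ?V \<pi> s"
  \<comment> \<open>Policies are only partially ordered by their values. The total over the states
    is a single number, which has a maximizer among the finitely many policies.\<close>
  obtain \<pi> where \<pi>: "\<And>\<pi>'. ?tot \<pi>' \<le> ?tot \<pi>"
    using finite_type_maximizer[of ?tot] by blast
  have "\<forall>s. \<exists>a. \<forall>b. action_value (?V \<pi>) s b \<le> action_value (?V \<pi>) s a"
    by (intro allI finite_type_maximizer)
  from choice[OF this] obtain \<pi>' where greedy: "\<And>s b. action_value (?V \<pi>) s b \<le> action_value (?V \<pi>) s (\<pi>' s)"
    by blast
  have le: "?V \<pi> s \<le> action_value (?V \<pi>) s (\<pi>' s)" for s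
    using policy_value_fixed_point[of \<pi> s] greedy[of s "\<pi> s"] by simp
  have improve: "?V \<pi> s \<le> ?V \<pi>' s" for s
    by (rule policy_value_ge[OF policy_value_zero_weight le])
  \<comment> \<open>Improvement in every state together with maximality of the total forces equality
    in every state.\<close>
  have eq: "?V \<pi> s = ?V \<pi>' s" for s
    by (rule sum_mono_inv[of "?V \<pi>" UNIV "?V \<pi>'"]) (use improve \<pi>[of \<pi>'] in \<open>auto intro!: antisym sum_mono\<close>)
  then have fixed: "?V \<pi> s = action_value (?V \<pi>) s (\<pi>' s)" for s
    using policy_value_fixed_point[of \<pi>' s] by simp
  have "?V \<pi>'' s \<le> ?V \<pi> s" for \<pi>'' s
  proof (rule policy_value_le[OF policy_value_zero_weight])
    show "action_value (?V \<pi>) s (\<pi>'' s) \<le> ?V \<pi> s" for s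
      using greedy[of s "\<pi>'' s"] fixed[of s] by linarith
  qed
  then have opt: "optimal_value R p \<gamma> s = ?V \<pi> s" for s
    unfolding optimal_value_def by (intro cSup_eq_maximum) auto
  have Max_eq: "(MAX a. optimal_action_value R p \<gamma> s a) = action_value (?V \<pi>) s (\<pi>' s)"
    unfolding optimal_action_value_def opt using greedy by (intro Max_eqI) auto
  show "optimal_value R p \<gamma> s = (MAX a. optimal_action_value R p \<gamma> s a)"
    using opt[of s] fixed[of s] Max_eq by linarith
  show "optimal_value R p \<gamma> s = 0" if "\<xi> s = 0"
    using opt policy_value_zero_weight[OF that] by simp
qed

text \<open>Where \<open>\<xi> s = 0\<close> the contraction inequality has right-hand side 0, so
  the discounted average of the optimal value vanishes.\<close>

lemma optimal_action_value_zero_weight: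
  assumes "\<xi> s = 0"
  shows "optimal_action_value R p \<gamma> s a = 0"
proof -
  obtain c where "0 \<le> c" "\<And>s. \<bar>optimal_value R p \<gamma> s\<bar> \<le> c * \<xi> s"
    using weighted_bound[of "optimal_value R p \<gamma>"] optimal_value_zero_weight by blast
  from discounted_average_abs_le[OF this(2,1), of s a] show ?thesis
    using assms zero_weight_reward[OF assms] by (simp add: optimal_action_value_def)
qed

end

section \<open>Weights for the undiscounted problem with proper policies\<close>

lemma proper_policies_levels:
  fixes p :: "'s::finite \<Rightarrow> 'a::finite \<Rightarrow> 's pmf"
  assumes proper: "\<And>\<pi>. proper_policy p s1 \<pi>"
  obtains l :: "'s \<Rightarrow> nat" where "l s1 = 0"
    "\<And>s a. s \<noteq> s1 \<Longrightarrow> \<exists>s'. pmf (p s a) s' > 0 \<and> l s' < l s"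
proof -
  define L where "L k = ((\<lambda>A. A \<union> {s. \<forall>a. \<exists>s'\<in>A. pmf (p s a) s' > 0}) ^^ k) {s1}" for k
  have L0: "L 0 = {s1}" and LS: "L (Suc k) = L k \<union> {s. \<forall>a. \<exists>s'\<in>L k. pmf (p s a) s' > 0}" for k
    by (simp_all add: L_def)
  have mono: "j \<le> k \<Longrightarrow> L j \<subseteq> L k" for j k
    by (rule lift_Suc_mono_le[of L]) (auto simp: LS)
  define U where "U = - (\<Union>k. L k)"
  have s1: "s1 \<notin> U" using L0 by (auto simp: U_def)
  have "\<exists>a. set_pmf (p s a) \<subseteq> U" if "s \<in> U" for s
  proof (rule ccontr)
    assume "\<nexists>a. set_pmf (p s a) \<subseteq> U"
    then have "\<forall>a. \<exists>k s'. s' \<in> L k \<and> pmf (p s a) s' > 0"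
      by (simp add: U_def subset_eq pmf_positive_iff) blast
    then obtain k where k: "\<And>a. \<exists>s'. s' \<in> L (k a) \<and> pmf (p s a) s' > 0"
      by (auto dest!: choice)
    \<comment> \<open>Each action has its own index \<open>k a\<close>; since actions are finite and
      the sets grow, the largest index serves all of them.\<close>
    have "k a \<le> Max (range k)" for a by simp
    then have "\<forall>a. \<exists>s'\<in>L (Max (range k)). pmf (p s a) s' > 0"
      using k mono by (meson subsetD)
    then have "s \<in> L (Suc (Max (range k)))" by (simp add: LS)
    then show False using that by (auto simp: U_def)
  qed
  then have "\<forall>s. \<exists>a. s \<in> U \<longrightarrow> set_pmf (p s a) \<subseteq> U" by blast
  from choice[OF this] obtain \<pi> where \<pi>: "\<And>s. s \<in> U \<Longrightarrow> set_pmf (p s (\<pi> s)) \<subseteq> U" by blast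
  have "U = {}"
  proof (rule ccontr)
    assume "U \<noteq> {}"
    then obtain s where s: "s \<in> U" by blast
    have stay: "set xs \<subseteq> U" if "xs \<in> set_pmf (trajectory p \<pi> s T)" for T xs
      using that
    proof (induction T arbitrary: xs)
      case (Suc T)
      then obtain ys s' where ys: "ys \<in> set_pmf (trajectory p \<pi> s T)" "xs = ys @ [s']"
        "s' \<in> set_pmf (p (last ys) (\<pi> (last ys)))" by auto
      have "ys \<noteq> []" using length_trajectory[OF ys(1)] by auto
      then have "last ys \<in> U" using Suc.IH[OF ys(1)] last_in_set by blast
      then show ?case using \<pi> ys Suc.IH[OF ys(1)] by auto
    qed (use s in simp)
    have "measure_pmf.prob (trajectory p \<pi> s t) {xs. xs ! t = s1} = 0" for t
      unfolding measure_pmf_zero_iff using stay[of _ t] length_trajectory[of _ p \<pi> s t] s1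
      by (auto simp: disjoint_iff) (metis lessI nth_mem subsetD)
    moreover have "(\<lambda>t. measure_pmf.prob (trajectory p \<pi> s t) {xs. xs ! t = s1}) \<longlonglongrightarrow> 1"
      using proper[of \<pi>] by (simp add: proper_policy_def)
    ultimately show False by (simp add: LIMSEQ_const_iff)
  qed
  then have ex: "\<exists>k. s \<in> L k" for s by (auto simp: U_def)
  define l where "l s = (LEAST k. s \<in> L k)" for s
  have l: "s \<in> L (l s)" for s
    unfolding l_def by (rule LeastI_ex[OF ex])
  have l_le: "s \<in> L k \<Longrightarrow> l s \<le> k" for s k
    unfolding l_def by (rule Least_le)
  show ?thesis
  proof
    show "l s1 = 0" using l_le[of s1 0] L0 by simp
    show "\<exists>s'. pmf (p s a) s' > 0 \<and> l s' < l s" if "s \<noteq> s1" for s a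
    proof (cases "l s")
      case 0
      then show ?thesis using l[of s] L0 that by simp
    next
      case (Suc k)
      then have "s \<in> L (Suc k)" "s \<notin> L k" using l[of s] l_le[of s k] by auto
      then obtain s' where "s' \<in> L k" "pmf (p s a) s' > 0" by (auto simp: LS)
      then show ?thesis using l_le[of s' k] Suc by force
    qed
  qed
qed

text \<open>For one successor \<open>s'\<close> of lower level, \<open>\<delta> ^ l s \<le> \<delta>
  * \<delta> ^ l s' < pmf (p s a) s' * \<delta> ^ l s'\<close>, so the mean of
  \<open>\<delta> ^ l\<close> after a transition exceeds its value at \<open>s\<close>. Finiteness
  turns this strict drop of \<open>\<xi>\<close> into a uniform factor.\<close>

lemma proper_policies_weights:
  fixes p :: "'s::finite \<Rightarrow> 'a::finite \<Rightarrow> 's pmf"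
  assumes absorbing: "\<And>a. pmf (p s1 a) s1 = 1" and proper: "\<And>\<pi>. proper_policy p s1 \<pi>"
  obtains \<xi> :: "'s \<Rightarrow> real" and \<beta> :: real where "0 \<le> \<beta>" "\<beta> < 1"
    "\<And>s. 0 \<le> \<xi> s" "\<And>s. \<xi> s = 0 \<longleftrightarrow> s = s1"
    "\<And>s a. (\<Sum>s'\<in>UNIV. pmf (p s a) s' * \<xi> s') \<le> \<beta> * \<xi> s"
proof -
  obtain l :: "'s \<Rightarrow> nat" where l: "l s1 = 0" "\<And>s a. s \<noteq> s1 \<Longrightarrow> \<exists>s'. pmf (p s a) s' > 0 \<and> l s' < l s"
    using proper_policies_levels[of p s1] proper by blast
  \<comment> \<open>The entry 1 gives nonemptiness and \<open>Min P \<le> 1\<close>; halving the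
    minimum below makes \<open>\<delta>\<close> strictly smaller than every positive transition
    probability.\<close>
  define P where "P = insert 1 {x \<in> range (\<lambda>(s, a, s'). pmf (p s a) s'). 0 < x}"
  have P: "finite P" "P \<noteq> {}" "\<And>x. x \<in> P \<Longrightarrow> 0 < x"
    by (auto simp: P_def)
  define \<delta> where "\<delta> = Min P / 2"
  have "1 \<in> P" by (simp add: P_def)
  then have "Min P \<le> 1" by (rule Min_le[OF P(1)])
  moreover have "0 < Min P" by (rule P(3)[OF Min_in[OF P(1,2)]])
  ultimately have \<delta>: "0 < \<delta>" "\<delta> < 1" by (auto simp: \<delta>_def)
  have \<delta>_less: "\<delta> < pmf (p s a) s'" if "pmf (p s a) s' > 0" for s a s'
  proof -
    have "pmf (p s a) s' \<in> range (\<lambda>(s, a, s'). pmf (p s a) s')"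
      by (rule image_eqI[of _ _ "(s, a, s')"]) auto
    then have "pmf (p s a) s' \<in> P" using that unfolding P_def by blast
    from Min_le[OF P(1) this] \<open>0 < Min P\<close> show ?thesis unfolding \<delta>_def by linarith
  qed
  \<comment> \<open>The level drops with probability above \<open>\<delta>\<close>, which outweighs every possible rise of \<open>1 - \<delta> ^ l\<close>.\<close>
  define \<xi> where "\<xi> s = 1 - \<delta> ^ l s" for s
  have nonneg: "0 \<le> \<xi> s" for s using \<delta> by (simp add: \<xi>_def power_le_one)
  have pos: "0 < \<xi> s" if "s \<noteq> s1" for s
  proof -
    have "0 < l s" using l(2)[OF that] by force
    then show ?thesis using power_strict_decreasing[of 0 "l s" \<delta>] \<delta> by (simp add: \<xi>_def)
  qed
  have zero: "\<xi> s1 = 0" using l(1) by (simp add: \<xi>_def)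
  let ?avg = "\<lambda>s a. \<Sum>s'\<in>UNIV. pmf (p s a) s' * \<xi> s'"
  have avg_nonneg: "0 \<le> ?avg s a" for s a using nonneg by (intro sum_nonneg) auto
  have strict: "?avg s a < \<xi> s" if s: "s \<noteq> s1" for s a
  proof -
    obtain s' where s': "pmf (p s a) s' > 0" "l s' < l s" using l(2)[OF s] by blast
    have "\<delta> ^ l s \<le> \<delta> ^ Suc (l s')" using s'(2) \<delta> by (intro power_decreasing) auto
    also have "\<dots> < pmf (p s a) s' * \<delta> ^ l s'" using \<delta>_less[OF s'(1)] \<delta> by simp
    also have "\<dots> \<le> (\<Sum>s'\<in>UNIV. pmf (p s a) s' * \<delta> ^ l s')"
      using \<delta> by (intro member_le_sum) auto
    finally show ?thesis
      using sum_pmf_eq_1[of UNIV "p s a"] by (simp add: \<xi>_def right_diff_distrib sum_subtractf)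
  qed
  have absorbed: "?avg s1 a = 0" for a
  proof -
    have "pmf (p s1 a) s' = 0" if "s' \<noteq> s1" for s'
    proof -
      have "(\<Sum>s'\<in>{s1, s'}. pmf (p s1 a) s') \<le> (\<Sum>s'\<in>UNIV. pmf (p s1 a) s')"
        by (intro sum_mono2) auto
      then show ?thesis using sum_pmf_eq_1[of UNIV "p s1 a"] absorbing[of a] that
        pmf_nonneg[of "p s1 a" s'] by simp
    qed
    then show ?thesis using zero by (intro sum.neutral) fastforce
  qed
  \<comment> \<open>At \<open>s1\<close> the ratio is a division by 0, hence 0, and is harmless in a
    maximum of nonnegative numbers.\<close>
  define \<beta> where "\<beta> = Max (range (\<lambda>(s, a). ?avg s a / \<xi> s))"
  have ratio: "?avg s a / \<xi> s \<le> \<beta>" for s a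
    unfolding \<beta>_def by (rule Max_ge) (auto intro!: image_eqI[of _ _ "(s, a)"])
  have "\<beta> \<in> range (\<lambda>(s, a). ?avg s a / \<xi> s)" unfolding \<beta>_def by (rule Max_in) auto
  then obtain s a where sa: "\<beta> = ?avg s a / \<xi> s" by auto
  show ?thesis
  proof
    show "0 \<le> \<beta>" using sa avg_nonneg nonneg by simp
    show "\<beta> < 1"
      using sa strict[of s a] pos[of s] zero by (cases "s = s1") auto
    show "0 \<le> \<xi> s" for s by (rule nonneg)
    show "\<xi> s = 0 \<longleftrightarrow> s = s1" for s using pos[of s] zero by (cases "s = s1") auto
    show "?avg s a \<le> \<beta> * \<xi> s" for s a
      using ratio[of s a] pos[of s] zero absorbed[of a] by (cases "s = s1") (auto simp: pos_divide_le_eq)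
  qed
qed

section \<open>Samples with a conditional law\<close>

context prob_space
begin

text \<open>The defining property of conditional expectation, integrated over \<open>A\<close>.
  Apart from measurability of \<open>X\<close>, conditional laws are used only through this product
  rule.\<close>

lemma has_cond_law_prob_Int:
  assumes sub: "subalgebra M G" and law: "has_cond_law M G X D"
    and A: "A \<in> sets G" and B: "B \<in> sets D"
  shows "prob (A \<inter> (X -` B \<inter> space M)) = prob A * measure D B"
proof -
  interpret G: finite_measure_subalgebra M G
    by unfold_locales (rule sub)
  have X [measurable]: "X \<in> measurable M D" using law by (simp add: has_cond_law_def)
  have A' [measurable]: "A \<in> sets M" using A sub by (auto simp: subalgebra_def)
  have XB [measurable]: "X -` B \<inter> space M \<in> sets M" using measurable_sets[OF X B] .
  have ce: "AE \<omega> in M. real_cond_exp M G (indicator (X -` B \<inter> space M)) \<omega> = measure D B"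
    using law B by (simp add: has_cond_law_def)
  have "prob (A \<inter> (X -` B \<inter> space M)) = (\<integral>\<omega>. indicator (A \<inter> (X -` B \<inter> space M)) \<omega> \<partial>M)"
    by simp
  also have "\<dots> = (\<integral>\<omega>\<in>A. indicator (X -` B \<inter> space M) \<omega> \<partial>M)"
    unfolding set_lebesgue_integral_def by (simp add: indicator_inter_arith)
  also have "\<dots> = (\<integral>\<omega>\<in>A. real_cond_exp M G (indicator (X -` B \<inter> space M)) \<omega> \<partial>M)"
    by (rule G.real_cond_exp_intA[OF _ A]) (simp add: integrable_indicator_iff emeasure_eq_measure)
  also have "\<dots> = (\<integral>\<omega>. indicator A \<omega> * measure D B \<partial>M)"
    unfolding set_lebesgue_integral_def
  proof (rule integral_cong_AE)
    have "real_cond_exp M G (indicator (X -` B \<inter> space M)) \<in> borel_measurable M" by simp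
    then show "(\<lambda>\<omega>. indicator A \<omega> *\<^sub>R real_cond_exp M G (indicator (X -` B \<inter> space M)) \<omega>) \<in> borel_measurable M"
      by measurable
  qed (use ce in auto)
  also have "\<dots> = prob A * measure D B" by simp
  finally show ?thesis .
qed

lemma has_cond_law_distr:
  assumes sub: "subalgebra M G" and law: "has_cond_law M G X D" and D: "prob_space D"
  shows "distr M D X = D"
proof (rule measure_eqI)
  interpret D: prob_space D by (rule D)
  have X [measurable]: "X \<in> measurable M D" using law by (simp add: has_cond_law_def)
  have sp: "space M \<in> sets G" using sub sets.top[of G] by (simp add: subalgebra_def)
  fix B assume "B \<in> sets (distr M D X)"
  then have B: "B \<in> sets D" by simp
  have "space M \<inter> (X -` B \<inter> space M) = X -` B \<inter> space M" by auto
  with has_cond_law_prob_Int[OF sub law sp B] have "prob (X -` B \<inter> space M) = measure D B"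
    by (simp add: prob_space)
  then show "emeasure (distr M D X) B = emeasure D B"
    using B by (simp add: emeasure_distr emeasure_eq_measure D.emeasure_eq_measure)
qed simp

text \<open>A deterministic conditional law amounts to independence from \<open>G\<close>. Preimages
  of Borel sets are stable under intersection, so the product rule for them suffices. In this form
  the samples become \<open>innovations\<close>.\<close>

lemma has_cond_law_indep_var:
  assumes sub: "subalgebra M G" and law: "has_cond_law M G X D" and D: "prob_space D"
    and Z: "Z \<in> borel_measurable G" and h: "h \<in> borel_measurable D"
  shows "indep_var borel Z borel (\<lambda>\<omega>. h (X \<omega>) :: real)"
proof -
  have X [measurable]: "X \<in> measurable M D" using law by (simp add: has_cond_law_def)
  have sp: "space G = space M" using sub by (simp add: subalgebra_def)
  have Z' [measurable]: "Z \<in> borel_measurable M" by (rule measurable_from_subalg[OF sub Z])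
  have hX [measurable]: "(\<lambda>\<omega>. h (X \<omega>)) \<in> borel_measurable M" using h by measurable
  have X_prob: "prob (X -` B \<inter> space M) = measure D B" if "B \<in> sets D" for B
    using measure_distr[OF X that] by (simp add: has_cond_law_distr[OF sub law D])
  let ?\<A> = "{Z -` A \<inter> space M |A. A \<in> sets borel}" and ?\<B> = "{(\<lambda>\<omega>. h (X \<omega>)) -` B \<inter> space M |B. B \<in> sets borel}"
  have "indep_set (sigma_sets (space M) ?\<A>) (sigma_sets (space M) ?\<B>)"
  proof (rule indep_set_sigma_sets)
    show "indep_set ?\<A> ?\<B>"
      unfolding indep_sets2_eq
    proof (intro conjI ballI)
      show "?\<A> \<subseteq> events" using measurable_sets[OF Z'] by auto
      show "?\<B> \<subseteq> events" using measurable_sets[OF hX] by auto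
      fix A B assume "A \<in> ?\<A>" "B \<in> ?\<B>"
      then obtain A' B' where AB: "A = Z -` A' \<inter> space M" "A' \<in> sets borel"
        "B = (\<lambda>\<omega>. h (X \<omega>)) -` B' \<inter> space M" "B' \<in> sets borel" by auto
      have A: "A \<in> sets G" using measurable_sets[OF Z AB(2)] AB(1) sp by simp
      have hB: "h -` B' \<inter> space D \<in> sets D" using measurable_sets[OF h AB(4)] .
      have B: "B = X -` (h -` B' \<inter> space D) \<inter> space M"
        using measurable_space[OF X] AB(3) by auto
      show "prob (A \<inter> B) = prob A * prob B"
        unfolding B X_prob[OF hB] by (rule has_cond_law_prob_Int[OF sub law A hB])
    qed
    show "Int_stable ?\<A>"
    proof (rule Int_stableI)
      fix a b assume "a \<in> ?\<A>" "b \<in> ?\<A>"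
      then obtain A B where "a = Z -` A \<inter> space M" "b = Z -` B \<inter> space M" "A \<in> sets borel" "B \<in> sets borel" by auto
      then show "a \<inter> b \<in> ?\<A>" by (auto intro!: exI[of _ "A \<inter> B"])
    qed
    show "Int_stable ?\<B>"
    proof (rule Int_stableI)
      fix a b assume "a \<in> ?\<B>" "b \<in> ?\<B>"
      then obtain A B where "a = (\<lambda>\<omega>. h (X \<omega>)) -` A \<inter> space M" "b = (\<lambda>\<omega>. h (X \<omega>)) -` B \<inter> space M"
        "A \<in> sets borel" "B \<in> sets borel" by auto
      then show "a \<inter> b \<in> ?\<B>" by (auto intro!: exI[of _ "A \<inter> B"])
    qed
  qed
  then show ?thesis using Z' hX unfolding indep_var_eq by blast
qed

end

lemma distr_pair_snd:
  assumes "prob_space A" "prob_space B"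
  shows "distr (A \<Otimes>\<^sub>M B) B snd = B"
proof (rule measure_eqI)
  interpret A: prob_space A by fact
  interpret B: prob_space B by fact
  fix X assume "X \<in> sets (distr (A \<Otimes>\<^sub>M B) B snd)"
  then have X: "X \<in> sets B" by simp
  have "snd -` X \<inter> space (A \<Otimes>\<^sub>M B) = space A \<times> X" using sets.sets_into_space[OF X] by (auto simp: space_pair_measure)
  then show "emeasure (distr (A \<Otimes>\<^sub>M B) B snd) X = emeasure B X"
    using X by (simp add: emeasure_distr B.emeasure_pair_measure_Times A.emeasure_space_1)
qed simp

lemma prob_space_sample_law:
  assumes "\<And>s a. real_distribution (R s a)"
  shows "prob_space (sample_law R p)"
  unfolding sample_law_def using assms
  by (intro prob_space_PiM prob_space_pair) (auto simp: real_distribution_def measure_pmf.prob_space_axioms)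

lemma sample_law_component:
  fixes R :: "'s::finite \<Rightarrow> 'a::finite \<Rightarrow> real measure"
  assumes "\<And>s a. real_distribution (R s a)"
  shows measurable_sample_law_reward: "(\<lambda>y. fst (y (s, a))) \<in> measurable (sample_law R p) (R s a)"
    and measurable_sample_law_successor: "(\<lambda>y. snd (y (s, a))) \<in> measurable (sample_law R p) (measure_pmf (p s a))"
    and distr_sample_law_reward: "distr (sample_law R p) (R s a) (\<lambda>y. fst (y (s, a))) = R s a"
    and distr_sample_law_successor:
      "distr (sample_law R p) (measure_pmf (p s a)) (\<lambda>y. snd (y (s, a))) = measure_pmf (p s a)"
proof -
  let ?P = "\<lambda>k. R (fst k) (snd k) \<Otimes>\<^sub>M measure_pmf (p (fst k) (snd k))"
  have R: "prob_space (R s a)" for s a using assms by (simp add: real_distribution_def)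
  have P: "prob_space (?P k)" for k by (intro prob_space_pair R measure_pmf.prob_space_axioms)
  have m: "(\<lambda>y. y (s, a)) \<in> measurable (sample_law R p) (R s a \<Otimes>\<^sub>M measure_pmf (p s a))"
    using measurable_component_singleton[of "(s, a)" UNIV ?P] by (simp add: sample_law_def)
  have d: "distr (sample_law R p) (R s a \<Otimes>\<^sub>M measure_pmf (p s a)) (\<lambda>y. y (s, a)) = R s a \<Otimes>\<^sub>M measure_pmf (p s a)"
    using distr_PiM_component[of UNIV ?P "(s, a)", OF P] by (simp add: sample_law_def)
  show "(\<lambda>y. fst (y (s, a))) \<in> measurable (sample_law R p) (R s a)"
    by (rule measurable_compose[OF m measurable_fst])
  show "(\<lambda>y. snd (y (s, a))) \<in> measurable (sample_law R p) (measure_pmf (p s a))"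
    by (rule measurable_compose[OF m measurable_snd])
  show "distr (sample_law R p) (R s a) (\<lambda>y. fst (y (s, a))) = R s a"
    using distr_distr[OF measurable_fst m] prob_space.distr_pair_fst[OF measure_pmf.prob_space_axioms, of "R s a" "p s a"]
    by (simp add: d o_def)
  show "distr (sample_law R p) (measure_pmf (p s a)) (\<lambda>y. snd (y (s, a))) = measure_pmf (p s a)"
    using distr_distr[OF measurable_snd m] distr_pair_snd[OF R measure_pmf.prob_space_axioms, of s a "p s a"]
    by (simp add: d o_def)
qed

section \<open>Q-learning\<close>

lemma abs_Max_image_diff_le:
  fixes x :: "'j \<Rightarrow> real"
  assumes J: "finite J" "J \<noteq> {}" and x: "\<And>j. j \<in> J \<Longrightarrow> \<bar>x j - y j\<bar> \<le> b"
  shows "\<bar>Max (x ` J) - Max (y ` J)\<bar> \<le> b"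
proof -
  have "Max (x ` J) \<le> Max (y ` J) + b"
  proof (rule Max.boundedI)
    fix z assume "z \<in> x ` J"
    then obtain j where "j \<in> J" "z = x j" by blast
    moreover from this have "y j \<le> Max (y ` J)" using J by simp
    ultimately show "z \<le> Max (y ` J) + b" using x[of j] by linarith
  qed (use J in auto)
  moreover have "Max (y ` J) \<le> Max (x ` J) + b"
  proof (rule Max.boundedI)
    fix z assume "z \<in> y ` J"
    then obtain j where "j \<in> J" "z = y j" by blast
    moreover from this have "x j \<le> Max (x ` J)" using J by simp
    ultimately show "z \<le> Max (x ` J) + b" using x[of j] by linarith
  qed (use J in auto)
  ultimately show ?thesis by linarith
qed

lemma abs_average_diff_le:
  fixes x :: "'j \<Rightarrow> real"
  assumes J: "finite J" "J \<noteq> {}" and x: "\<And>j. j \<in> J \<Longrightarrow> \<bar>x j - y\<bar> \<le> b"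
  shows "\<bar>1 / real (card J) * (\<Sum>j\<in>J. x j) - y\<bar> \<le> b"
proof -
  have n: "0 < real (card J)" using J by (simp add: card_gt_0_iff)
  have "1 / real (card J) * (\<Sum>j\<in>J. x j) - y = (\<Sum>j\<in>J. x j - y) / real (card J)"
    using n by (simp add: sum_subtractf field_simps)
  moreover have "\<bar>\<Sum>j\<in>J. x j - y\<bar> \<le> (\<Sum>j\<in>J. b)"
    by (rule order_trans[OF sum_abs]) (intro sum_mono x)
  ultimately show ?thesis using n by (simp add: field_simps)
qed

text \<open>Means and maxima of numbers within \<open>b\<close> of \<open>v a\<close> stay within
  \<open>b\<close> of it, and maximizing over actions does not enlarge distances. Together with
  \<open>bootstrap_measurable\<close> this is all that the convergence proof uses about the three
  variants.\<close>

lemma bootstrap_nonexpansive: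
  fixes q :: "nat \<Rightarrow> int \<Rightarrow> 's \<Rightarrow> 'a::finite \<Rightarrow> real"
  assumes B: "K = 1 \<and> B = ensemble_bootstrap N \<or> N = 1 \<and> B = averaged_bootstrap K \<or>
      N = 1 \<and> B = historical_best_bootstrap K"
    and NK: "N \<ge> 1" "K \<ge> 1"
    and q: "\<And>i j a. i \<in> {1..N} \<Longrightarrow> j < K \<Longrightarrow> \<bar>q i (t - int j) s a - v a\<bar> \<le> b"
  shows "\<bar>B q t s - (MAX a. v a)\<bar> \<le> b"
  using B
proof (elim disjE conjE)
  assume *: "K = 1" "B = ensemble_bootstrap N"
  have "\<bar>1 / real N * (\<Sum>i=1..N. q i t s a) - v a\<bar> \<le> b" for a
    using abs_average_diff_le[of "{1..N}" "\<lambda>i. q i t s a" "v a" b] q[of _ 0 a] NK *(1) by simp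
  then show ?thesis unfolding * ensemble_bootstrap_def by (intro abs_Max_image_diff_le) auto
next
  assume *: "N = 1" "B = averaged_bootstrap K"
  have "\<bar>1 / real K * (\<Sum>j<K. q 1 (t - int j) s a) - v a\<bar> \<le> b" for a
    using abs_average_diff_le[of "{..<K}" "\<lambda>j. q 1 (t - int j) s a" "v a" b] q[of 1 _ a] NK *(1)
    by (simp add: lessThan_empty_iff)
  then show ?thesis unfolding * averaged_bootstrap_def by (intro abs_Max_image_diff_le) auto
next
  assume *: "N = 1" "B = historical_best_bootstrap K"
  have K: "{..<K} \<noteq> {}" using NK by (simp add: lessThan_empty_iff)
  have "\<bar>(MAX j\<in>{..<K}. q 1 (t - int j) s a) - v a\<bar> \<le> b" for a
    using abs_Max_image_diff_le[of "{..<K}" "\<lambda>j. q 1 (t - int j) s a" "\<lambda>_. v a" b] q[of 1 _ a] K *(1) by simp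
  then show ?thesis unfolding * historical_best_bootstrap_def by (intro abs_Max_image_diff_le) auto
qed

lemma bootstrap_measurable:
  fixes Q :: "nat \<Rightarrow> int \<Rightarrow> 'w \<Rightarrow> 's \<Rightarrow> 'a::finite \<Rightarrow> real"
  assumes B: "K = 1 \<and> B = ensemble_bootstrap N \<or> N = 1 \<and> B = averaged_bootstrap K \<or>
      N = 1 \<and> B = historical_best_bootstrap K"
    and Q: "\<And>i j a. i \<in> {1..N} \<Longrightarrow> j < K \<Longrightarrow> (\<lambda>\<omega>. Q i (t - int j) \<omega> s a) \<in> borel_measurable G"
  shows "(\<lambda>\<omega>. B (\<lambda>i \<tau>. Q i \<tau> \<omega>) t s) \<in> borel_measurable G"
  using B
proof (elim disjE conjE)
  assume *: "K = 1" "B = ensemble_bootstrap N"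
  show ?thesis unfolding * ensemble_bootstrap_def
    using Q[of _ 0] *(1) by (intro borel_measurable_Max borel_measurable_times borel_measurable_sum) auto
next
  assume *: "N = 1" "B = averaged_bootstrap K"
  show ?thesis unfolding * averaged_bootstrap_def
    using Q[of 1] *(1) by (intro borel_measurable_Max borel_measurable_times borel_measurable_sum) auto
next
  assume *: "N = 1" "B = historical_best_bootstrap K"
  show ?thesis unfolding * historical_best_bootstrap_def
    using Q[of 1] *(1) by (intro borel_measurable_Max) auto
qed

text \<open>The last two assumptions express case (ii) through the zero set of the weights. For
  positive weights they are vacuous, so one argument covers both cases.\<close>

locale q_learning = weighted_mdp R p \<gamma> \<beta> \<xi> + prob_space M
  for R :: "'s::finite \<Rightarrow> 'a::finite \<Rightarrow> real measure" and p :: "'s \<Rightarrow> 'a \<Rightarrow> 's pmf"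
    and \<gamma> \<beta> :: real and \<xi> :: "'s \<Rightarrow> real" and M :: "'w measure" +
  fixes C :: real
    and N K :: nat
    and F :: "nat \<Rightarrow> 'w measure"
    and Q :: "nat \<Rightarrow> int \<Rightarrow> 'w \<Rightarrow> 's \<Rightarrow> 'a \<Rightarrow> real"
    and \<alpha> :: "nat \<Rightarrow> nat \<Rightarrow> 'w \<Rightarrow> 's \<Rightarrow> 'a \<Rightarrow> real"
    and r :: "nat \<Rightarrow> 'w \<Rightarrow> 's \<Rightarrow> 'a \<Rightarrow> real"
    and f :: "nat \<Rightarrow> 'w \<Rightarrow> 's \<Rightarrow> 'a \<Rightarrow> 's"
    and B :: "(nat \<Rightarrow> int \<Rightarrow> 's \<Rightarrow> 'a \<Rightarrow> real) \<Rightarrow> int \<Rightarrow> 's \<Rightarrow> real"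
  assumes finite_variance: "\<And>s a. integrable (R s a) (\<lambda>x. x\<^sup>2)"
    and N: "N \<ge> 1" and K: "K \<ge> 1"
    and history: "filtration (space M) F" "\<And>t. subalgebra M (F t)"
    and initial_measurable:
      "\<And>i \<tau> s a. i \<in> {1..N} \<Longrightarrow> \<tau> \<in> {- int K + 1..0} \<Longrightarrow>
         (\<lambda>\<omega>. Q i \<tau> \<omega> s a) \<in> borel_measurable (F 0)"
    and step_measurable:
      "\<And>i t s a. i \<in> {1..N} \<Longrightarrow> (\<lambda>\<omega>. \<alpha> i t \<omega> s a) \<in> borel_measurable (F t)"
    and reward_measurable: "\<And>t s a. (\<lambda>\<omega>. r t \<omega> s a) \<in> borel_measurable (F (Suc t))"
    and successor_measurable:
      "\<And>t s a. (\<lambda>\<omega>. f t \<omega> s a) \<in> measurable (F (Suc t)) (count_space UNIV)"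
    and samples:
      "\<And>t. has_cond_law M (F t) (\<lambda>\<omega> (s, a). (r t \<omega> s a, f t \<omega> s a)) (sample_law R p)"
    and bootstrap:
      "K = 1 \<and> B = ensemble_bootstrap N \<or>
       N = 1 \<and> B = averaged_bootstrap K \<or>
       N = 1 \<and> B = historical_best_bootstrap K"
    and iteration:
      "\<And>i t \<omega> s a. i \<in> {1..N} \<Longrightarrow> \<omega> \<in> space M \<Longrightarrow>
         Q i (int t + 1) \<omega> s a =
           Q i (int t) \<omega> s a +
           \<alpha> i t \<omega> s a *
             (r t \<omega> s a + \<gamma> * B (\<lambda>j \<tau>. Q j \<tau> \<omega>) (int t) (f t \<omega> s a) - Q i (int t) \<omega> s a)"
    and step_bounds:
      "\<And>i t \<omega> s a. i \<in> {1..N} \<Longrightarrow> \<omega> \<in> space M \<Longrightarrow> 0 \<le> \<alpha> i t \<omega> s a \<and> \<alpha> i t \<omega> s a \<le> 1"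
    and step_squares:
      "\<And>i s a. i \<in> {1..N} \<Longrightarrow>
         AE \<omega> in M. summable (\<lambda>t. (\<alpha> i t \<omega> s a)\<^sup>2) \<and> (\<Sum>t. (\<alpha> i t \<omega> s a)\<^sup>2) \<le> C"
    and step_diverges:
      "\<And>i s a. i \<in> {1..N} \<Longrightarrow>
         AE \<omega> in M. filterlim (\<lambda>n. \<Sum>t<n. \<alpha> i t \<omega> s a) at_top sequentially"
    and initial_zero: "\<And>i \<tau> \<omega> s a. i \<in> {1..N} \<Longrightarrow> \<tau> \<in> {- int K + 1..0} \<Longrightarrow> \<omega> \<in> space M \<Longrightarrow>
      \<xi> s = 0 \<Longrightarrow> Q i \<tau> \<omega> s a = 0"
    and zero_weight_absorbing: "\<And>s a. \<xi> s = 0 \<Longrightarrow> pmf (p s a) s = 1 \<and> (AE x in R s a. x = 0)"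
begin

lemma distr_reward: "(\<lambda>\<omega>. r t \<omega> s a) \<in> measurable M (R s a)" "distr M (R s a) (\<lambda>\<omega>. r t \<omega> s a) = R s a"
proof -
  let ?X = "\<lambda>\<omega> (s, a). (r t \<omega> s a, f t \<omega> s a)"
  have X: "?X \<in> measurable M (sample_law R p)" using samples[of t] by (simp add: has_cond_law_def)
  have d: "distr M (sample_law R p) ?X = sample_law R p"
    by (rule has_cond_law_distr[OF history(2) samples prob_space_sample_law[OF reward_law]])
  note m = measurable_sample_law_reward[where R=R and p=p and s=s and a=a, OF reward_law]
  show "(\<lambda>\<omega>. r t \<omega> s a) \<in> measurable M (R s a)"
    using measurable_compose[OF X m] by simp
  show "distr M (R s a) (\<lambda>\<omega>. r t \<omega> s a) = R s a"
    using distr_distr[OF m X] distr_sample_law_reward[where R=R and p=p and s=s and a=a, OF reward_law] by (simp add: d o_def)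
qed

lemma distr_successor:
  "(\<lambda>\<omega>. f t \<omega> s a) \<in> measurable M (measure_pmf (p s a))"
  "distr M (measure_pmf (p s a)) (\<lambda>\<omega>. f t \<omega> s a) = measure_pmf (p s a)"
proof -
  let ?X = "\<lambda>\<omega> (s, a). (r t \<omega> s a, f t \<omega> s a)"
  have X: "?X \<in> measurable M (sample_law R p)" using samples[of t] by (simp add: has_cond_law_def)
  have d: "distr M (sample_law R p) ?X = sample_law R p"
    by (rule has_cond_law_distr[OF history(2) samples prob_space_sample_law[OF reward_law]])
  note m = measurable_sample_law_successor[where R=R and p=p and s=s and a=a, OF reward_law]
  show "(\<lambda>\<omega>. f t \<omega> s a) \<in> measurable M (measure_pmf (p s a))"
    using measurable_compose[OF X m] by simp
  show "distr M (measure_pmf (p s a)) (\<lambda>\<omega>. f t \<omega> s a) = measure_pmf (p s a)"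
    using distr_distr[OF m X] distr_sample_law_successor[where R=R and p=p and s=s and a=a, OF reward_law] by (simp add: d o_def)
qed

lemma sets_R: "sets (R s a) = sets borel"
  using reward_law by (simp add: real_distribution_def real_distribution_axioms_def)

definition reward_noise :: "'s \<Rightarrow> 'a \<Rightarrow> nat \<Rightarrow> 'w \<Rightarrow> real" where
  "reward_noise s a t \<omega> = r t \<omega> s a - (\<integral>x. x \<partial>R s a)"

text \<open>One scalar innovation per possible successor: the bootstrap value at the sampled state,
  minus its mean, is a linear combination of these, with coefficients known at time
  \<open>t\<close>.\<close>

definition successor_noise :: "'s \<Rightarrow> 'a \<Rightarrow> 's \<Rightarrow> nat \<Rightarrow> 'w \<Rightarrow> real" where
  "successor_noise s a s' t \<omega> = indicator {s'} (f t \<omega> s a) - pmf (p s a) s'"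

lemma expectation_reward:
  fixes g :: "real \<Rightarrow> real"
  assumes "g \<in> borel_measurable borel"
  shows "integrable M (\<lambda>\<omega>. g (r t \<omega> s a)) \<longleftrightarrow> integrable (R s a) g"
    and "expectation (\<lambda>\<omega>. g (r t \<omega> s a)) = (\<integral>x. g x \<partial>R s a)"
proof -
  have g: "g \<in> borel_measurable (R s a)" using assms by (simp add: measurable_cong_sets[OF sets_R])
  show "integrable M (\<lambda>\<omega>. g (r t \<omega> s a)) \<longleftrightarrow> integrable (R s a) g"
    using integrable_distr_eq[OF distr_reward(1) g] by (simp add: distr_reward(2))
  show "expectation (\<lambda>\<omega>. g (r t \<omega> s a)) = (\<integral>x. g x \<partial>R s a)"
    using integral_distr[OF distr_reward(1) g] by (simp add: distr_reward(2))
qed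

lemma expectation_successor:
  fixes g :: "'s \<Rightarrow> real"
  shows "integrable M (\<lambda>\<omega>. g (f t \<omega> s a))"
    and "expectation (\<lambda>\<omega>. g (f t \<omega> s a)) = measure_pmf.expectation (p s a) g"
proof -
  show "integrable M (\<lambda>\<omega>. g (f t \<omega> s a))"
    using integrable_distr_eq[OF distr_successor(1), of g] integrable_measure_pmf_finite[of "p s a" g]
    by (simp add: distr_successor(2))
  show "expectation (\<lambda>\<omega>. g (f t \<omega> s a)) = measure_pmf.expectation (p s a) g"
    using integral_distr[OF distr_successor(1), of g] by (simp add: distr_successor(2))
qed

lemma innovations_reward: "innovations M F (reward_noise s a)"
proof (intro innovations.intro innovations_axioms.intro prob_space_axioms)
  note D = prob_space_sample_law[where R=R and p=p, OF reward_law]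
  show "filtration (space M) F" "subalgebra M (F t)" for t by (fact history)+
  show "reward_noise s a t \<in> borel_measurable (F (Suc t))" for t
    unfolding reward_noise_def using reward_measurable by measurable
  have "integrable (R s a) (\<lambda>x. (x - c)\<^sup>2)" for c
  proof -
    interpret R: real_distribution "R s a" by (rule reward_law)
    show ?thesis using finite_variance[of s a] reward_integrable[of s a] by (simp add: power2_diff)
  qed
  then show "integrable M (\<lambda>\<omega>. (reward_noise s a t \<omega>)\<^sup>2)" for t
    unfolding reward_noise_def by (subst expectation_reward(1)) auto
  show "expectation (reward_noise s a t) = 0" for t
  proof -
    interpret R: real_distribution "R s a" by (rule reward_law)
    have "expectation (reward_noise s a t) = (\<integral>x. x - (\<integral>x. x \<partial>R s a) \<partial>R s a)"
      unfolding reward_noise_def by (rule expectation_reward(2)) simp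
    also have "\<dots> = 0" using reward_integrable[of s a] R.prob_space by simp
    finally show ?thesis .
  qed
  fix t and Z :: "'w \<Rightarrow> real" assume Z: "Z \<in> borel_measurable (F t)"
  have "(\<lambda>y. fst (y (s, a))) \<in> borel_measurable (sample_law R p)"
    using measurable_sample_law_reward[where R=R and p=p and s=s and a=a, OF reward_law]
    unfolding measurable_cong_sets[OF refl sets_R] .
  then have "(\<lambda>y. fst (y (s, a)) - (\<integral>x. x \<partial>R s a)) \<in> borel_measurable (sample_law R p)"
    by measurable
  from has_cond_law_indep_var[OF history(2) samples D Z this]
  show "indep_var borel Z borel (reward_noise s a t)" by (simp add: reward_noise_def[abs_def])
qed

lemma innovations_successor: "innovations M F (successor_noise s a s')"
proof (intro innovations.intro innovations_axioms.intro prob_space_axioms)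
  note D = prob_space_sample_law[where R=R and p=p, OF reward_law]
  show "filtration (space M) F" "subalgebra M (F t)" for t by (fact history)+
  show "successor_noise s a s' t \<in> borel_measurable (F (Suc t))" for t
    unfolding successor_noise_def
    by (intro borel_measurable_diff measurable_compose[OF successor_measurable]) auto
  show "integrable M (\<lambda>\<omega>. (successor_noise s a s' t \<omega>)\<^sup>2)" for t
    unfolding successor_noise_def by (rule expectation_successor(1))
  show "expectation (successor_noise s a s' t) = 0" for t
  proof -
    have "expectation (successor_noise s a s' t) =
      measure_pmf.expectation (p s a) (\<lambda>x. indicator {s'} x - pmf (p s a) s')"
      unfolding successor_noise_def by (rule expectation_successor(2))
    also have "\<dots> = 0"
      by (subst Bochner_Integration.integral_diff) (auto simp: integrable_measure_pmf_finite measure_pmf_single)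
    finally show ?thesis .
  qed
  fix t and Z :: "'w \<Rightarrow> real" assume Z: "Z \<in> borel_measurable (F t)"
  have "(\<lambda>y. indicator {s'} (snd (y (s, a))) - pmf (p s a) s' :: real) \<in> borel_measurable (sample_law R p)"
    by (intro borel_measurable_diff measurable_compose[OF measurable_sample_law_successor[OF reward_law]]) auto
  from has_cond_law_indep_var[OF history(2) samples D Z this]
  show "indep_var borel Z borel (successor_noise s a s' t)" by (simp add: successor_noise_def[abs_def])
qed

lemma noise_variance:
  "expectation (\<lambda>\<omega>. (reward_noise s a t \<omega>)\<^sup>2) = (\<integral>x. (x - (\<integral>x. x \<partial>R s a))\<^sup>2 \<partial>R s a)"
  "expectation (\<lambda>\<omega>. (successor_noise s a s' t \<omega>)\<^sup>2) =
    measure_pmf.expectation (p s a) (\<lambda>x. (indicator {s'} x - pmf (p s a) s')\<^sup>2)"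
  unfolding reward_noise_def successor_noise_def
  by (rule expectation_reward(2), simp) (rule expectation_successor(2))

text \<open>\<open>C\<close> bounds the sum of squared steps on almost every path and hence in
  expectation, so the second moments of the coefficients sum to at most
  \<open>L\<^sup>2 * C\<close>.\<close>

lemma step_weighted_noise_converges:
  assumes u: "innovations M F u" and var: "\<And>t. expectation (\<lambda>\<omega>. (u t \<omega>)\<^sup>2) = \<sigma>"
    and i: "i \<in> {1..N}"
    and d: "\<And>t. d t \<in> borel_measurable (F t)" "\<And>t. AE \<omega> in M. \<bar>d t \<omega>\<bar> \<le> L"
  shows "AE \<omega> in M. convergent (\<lambda>n. \<Sum>t<n. (\<alpha> i t \<omega> s a * d t \<omega>) * u t \<omega>)"
proof -
  interpret u: innovations M F u by (rule u)
  let ?a = "\<lambda>t \<omega>. \<alpha> i t \<omega> s a"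
  let ?c = "\<lambda>t \<omega>. ?a t \<omega> * d t \<omega>"
  note a_meas = step_measurable[OF i, of _ s a]
  have c_meas: "?c t \<in> borel_measurable (F t)" for t using a_meas[of t] d(1)[of t] by measurable
  have a_int: "integrable M (\<lambda>\<omega>. (?a t \<omega>)\<^sup>2)" for t
  proof (rule integrable_const_bound[where B=1])
    show "AE \<omega> in M. norm ((?a t \<omega>)\<^sup>2) \<le> 1"
      using AE_space by eventually_elim (use step_bounds[OF i] in \<open>simp add: power_le_one\<close>)
    show "(\<lambda>\<omega>. (?a t \<omega>)\<^sup>2) \<in> borel_measurable M" using u.measurable_F[OF a_meas[of t]] by measurable
  qed
  have c_le: "AE \<omega> in M. (?c t \<omega>)\<^sup>2 \<le> L\<^sup>2 * (?a t \<omega>)\<^sup>2" for t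
    using d(2)[of t]
  proof eventually_elim
    case (elim \<omega>)
    then have "(d t \<omega>)\<^sup>2 \<le> L\<^sup>2" using power_mono[of "\<bar>d t \<omega>\<bar>" L 2] by simp
    then show ?case by (simp add: power_mult_distrib mult.commute mult_right_mono)
  qed
  have c_int: "integrable M (\<lambda>\<omega>. (?c t \<omega>)\<^sup>2)" for t
  proof (rule Bochner_Integration.integrable_bound)
    show "integrable M (\<lambda>\<omega>. L\<^sup>2 * (?a t \<omega>)\<^sup>2)" using a_int by simp
    show "(\<lambda>\<omega>. (?c t \<omega>)\<^sup>2) \<in> borel_measurable M" using u.measurable_F[OF c_meas[of t]] by measurable
    show "AE \<omega> in M. norm ((?c t \<omega>)\<^sup>2) \<le> norm (L\<^sup>2 * (?a t \<omega>)\<^sup>2)"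
      using c_le[of t] by eventually_elim simp
  qed
  have "summable (\<lambda>t. expectation (\<lambda>\<omega>. (?c t \<omega>)\<^sup>2))"
  proof (rule summableI_nonneg_bounded)
    fix n
    have "(\<Sum>t<n. expectation (\<lambda>\<omega>. (?c t \<omega>)\<^sup>2)) \<le> (\<Sum>t<n. expectation (\<lambda>\<omega>. L\<^sup>2 * (?a t \<omega>)\<^sup>2))"
      using c_int a_int c_le by (intro sum_mono integral_mono_AE) auto
    also have "\<dots> = L\<^sup>2 * expectation (\<lambda>\<omega>. \<Sum>t<n. (?a t \<omega>)\<^sup>2)"
      using a_int by (simp add: sum_distrib_left)
    also have "\<dots> \<le> L\<^sup>2 * C"
    proof (intro mult_left_mono integral_le_const)
      show "integrable M (\<lambda>\<omega>. \<Sum>t<n. (?a t \<omega>)\<^sup>2)" using a_int by simp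
      show "AE \<omega> in M. (\<Sum>t<n. (?a t \<omega>)\<^sup>2) \<le> C"
        using step_squares[OF i, of s a]
      proof eventually_elim
        case (elim \<omega>)
        then have "(\<Sum>t<n. (?a t \<omega>)\<^sup>2) \<le> (\<Sum>t. (?a t \<omega>)\<^sup>2)" by (intro sum_le_suminf) auto
        then show ?case using elim by linarith
      qed
    qed simp
    finally show "(\<Sum>t<n. expectation (\<lambda>\<omega>. (?c t \<omega>)\<^sup>2)) \<le> L\<^sup>2 * C" .
  qed simp
  then have "summable (\<lambda>t. expectation (\<lambda>\<omega>. (?c t \<omega>)\<^sup>2) * expectation (\<lambda>\<omega>. (u t \<omega>)\<^sup>2))"
    unfolding var by (rule summable_mult2)
  from u.transform_converges[where c="?c", OF c_meas c_int this] show ?thesis .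
qed

text \<open>
  Where \<open>\<xi>\<close> vanishes the estimates are almost surely exact, so the junk value \<open>x / 0 = 0\<close> is the right error.
\<close>

definition scaled_error :: "nat \<Rightarrow> int \<Rightarrow> 'w \<Rightarrow> 's \<Rightarrow> 'a \<Rightarrow> real" where
  "scaled_error i \<tau> \<omega> s a = (Q i \<tau> \<omega> s a - optimal_action_value R p \<gamma> s a) / \<xi> s"

definition past :: "nat \<Rightarrow> (nat \<times> int \<times> 's \<times> 'a) set" where
  "past t = {1..N} \<times> {- int K + 1..int t} \<times> UNIV \<times> UNIV"

text \<open>The entry 1 makes division legitimate and keeps the divided reward noise bounded in
  variance. Negative times are included so that the delayed errors are covered from the
  start.\<close>

definition magnitude :: "nat \<Rightarrow> 'w \<Rightarrow> real" where
  "magnitude t \<omega> = Max (insert 1 ((\<lambda>(i, \<tau>, s, a). \<bar>scaled_error i \<tau> \<omega> s a\<bar>) ` past t))"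

definition boot :: "nat \<Rightarrow> 'w \<Rightarrow> 's \<Rightarrow> real" where
  "boot t \<omega> s = B (\<lambda>j \<tau>. Q j \<tau> \<omega>) (int t) s"

definition drift :: "'s \<Rightarrow> 'a \<Rightarrow> nat \<Rightarrow> 'w \<Rightarrow> real" where
  "drift s a t \<omega> = \<gamma> * (\<Sum>s'\<in>UNIV. pmf (p s a) s' * (boot t \<omega> s' - optimal_value R p \<gamma> s')) / \<xi> s"

text \<open>Multiplied by \<open>magnitude t \<omega>\<close>, this is the deviation of the sampled
  target from its mean, in units of \<open>\<xi> s\<close>.\<close>

definition noise :: "'s \<Rightarrow> 'a \<Rightarrow> nat \<Rightarrow> 'w \<Rightarrow> real" where
  "noise s a t \<omega> = (reward_noise s a t \<omega> + \<gamma> * (\<Sum>s'\<in>UNIV. boot t \<omega> s' * successor_noise s a s' t \<omega>)) /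
    (magnitude t \<omega> * \<xi> s)"

text \<open>Membership in the sample space is included because \<open>iteration\<close> is assumed
  only there.\<close>

definition zero_preserved :: "'w \<Rightarrow> bool" where
  "zero_preserved \<omega> \<longleftrightarrow> \<omega> \<in> space M \<and>
    (\<forall>i\<in>{1..N}. \<forall>\<tau>\<ge>- int K + 1. \<forall>s a. \<xi> s = 0 \<longrightarrow> Q i \<tau> \<omega> s a = 0)"

section \<open>Measurability and pathwise recursion of the scaled errors\<close>

lemma finite_past: "finite (past t)"
  by (simp add: past_def)

lemma past_mono: "past t \<subseteq> past (Suc t)"
  by (auto simp: past_def)

lemma magnitude_ge_1: "1 \<le> magnitude t \<omega>"
  unfolding magnitude_def by (rule Max_ge) (auto simp: finite_past)

lemma scaled_error_le_magnitude:
  assumes "i \<in> {1..N}" "\<tau> \<in> {- int K + 1..int t}"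
  shows "\<bar>scaled_error i \<tau> \<omega> s a\<bar> \<le> magnitude t \<omega>"
proof -
  have "(i, \<tau>, s, a) \<in> past t" using assms by (simp add: past_def)
  from imageI[OF this, of "\<lambda>(i, \<tau>, s, a). \<bar>scaled_error i \<tau> \<omega> s a\<bar>"] show ?thesis
    unfolding magnitude_def by (intro Max_ge) (auto simp: finite_past)
qed

lemma incseq_magnitude: "incseq (\<lambda>t. magnitude t \<omega>)"
  unfolding magnitude_def
  by (intro incseq_SucI Max_mono Set.insert_mono image_mono past_mono) (simp_all add: finite_past)

text \<open>Older errors are already counted in the previous maximum. The deterministic theorem
  needs every new maximum to be attained by a current error.\<close>

lemma magnitude_Suc:
  "magnitude (Suc t) \<omega> \<le> magnitude t \<omega> \<or>
    (\<exists>i\<in>{1..N}. \<exists>s a. magnitude (Suc t) \<omega> = \<bar>scaled_error i (int (Suc t)) \<omega> s a\<bar>)"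
proof -
  have "magnitude (Suc t) \<omega> \<in> insert 1 ((\<lambda>(i, \<tau>, s, a). \<bar>scaled_error i \<tau> \<omega> s a\<bar>) ` past (Suc t))"
    unfolding magnitude_def by (rule Max_in) (auto simp: finite_past)
  then consider "magnitude (Suc t) \<omega> = 1"
    | i \<tau> s a where "(i, \<tau>, s, a) \<in> past (Suc t)" "magnitude (Suc t) \<omega> = \<bar>scaled_error i \<tau> \<omega> s a\<bar>"
    by auto
  then show ?thesis
  proof cases
    case 1
    then show ?thesis using magnitude_ge_1[of t \<omega>] by simp
  next
    case 2
    show ?thesis
    proof (cases "\<tau> = int (Suc t)")
      case True
      moreover have "i \<in> {1..N}" using 2(1) by (simp add: past_def)
      ultimately show ?thesis using 2(2) by blast
    next
      case False
      then have "i \<in> {1..N}" "\<tau> \<in> {- int K + 1..int t}" using 2(1) by (auto simp: past_def)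
      then show ?thesis using scaled_error_le_magnitude 2(2) by simp
    qed
  qed
qed

lemma window: "j < K \<Longrightarrow> int t - int j \<in> {- int K + 1..int t}"
  by auto

text \<open>Measurability of the estimates is a premise because this is used inside the induction
  that establishes it.\<close>

lemma boot_measurable_if:
  assumes "\<And>i \<tau> s a. i \<in> {1..N} \<Longrightarrow> \<tau> \<in> {- int K + 1..int t} \<Longrightarrow> (\<lambda>\<omega>. Q i \<tau> \<omega> s a) \<in> borel_measurable (F t)"
  shows "(\<lambda>\<omega>. boot t \<omega> s) \<in> borel_measurable (F t)"
  unfolding boot_def by (rule bootstrap_measurable[OF bootstrap]) (rule assms, simp, rule window, simp)

lemma Q_measurable:
  "i \<in> {1..N} \<Longrightarrow> \<tau> \<in> {- int K + 1..int t} \<Longrightarrow> (\<lambda>\<omega>. Q i \<tau> \<omega> s a) \<in> borel_measurable (F t)"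
proof (induction t arbitrary: i \<tau> s a)
  case 0
  then show ?case by (intro initial_measurable) auto
next
  case (Suc t)
  note mono = innovations.measurable_F_le[OF innovations_reward, of _ t _ "Suc t"]
  show ?case
  proof (cases "\<tau> = int t + 1")
    case False
    then have "\<tau> \<in> {- int K + 1..int t}" using Suc.prems by auto
    from mono[OF Suc.IH[OF Suc.prems(1) this]] show ?thesis by simp
  next
    case True
    have [measurable]: "(\<lambda>\<omega>. boot t \<omega> s') \<in> borel_measurable (F (Suc t))" for s'
      by (rule mono[OF boot_measurable_if]) (rule Suc.IH, auto)
    have [measurable]: "(\<lambda>\<omega>. Q i (int t) \<omega> s a) \<in> borel_measurable (F (Suc t))"
      by (rule mono[OF Suc.IH[OF Suc.prems(1)]]) (use K in auto)
    have [measurable]: "(\<lambda>\<omega>. \<alpha> i t \<omega> s a) \<in> borel_measurable (F (Suc t))"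
      by (rule mono[OF step_measurable[OF Suc.prems(1)]]) auto
    have [measurable]: "(\<lambda>\<omega>. r t \<omega> s a) \<in> borel_measurable (F (Suc t))" by (rule reward_measurable)
    have [measurable]: "(\<lambda>\<omega>. indicator {s'} (f t \<omega> s a) :: real) \<in> borel_measurable (F (Suc t))" for s'
      by (rule measurable_compose[OF successor_measurable]) simp
    \<comment> \<open>A random function is evaluated at a random state; the finite sum over
      indicators reduces this to products of measurable functions.\<close>
    have "Q i \<tau> \<omega> s a = Q i (int t) \<omega> s a + \<alpha> i t \<omega> s a *
        (r t \<omega> s a + \<gamma> * (\<Sum>s'\<in>UNIV. indicator {s'} (f t \<omega> s a) * boot t \<omega> s') - Q i (int t) \<omega> s a)"
      if "\<omega> \<in> space (F (Suc t))" for \<omega>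
    proof -
      have "\<omega> \<in> space M" using that innovations.space_F[OF innovations_reward] by auto
      moreover have "(\<Sum>s'\<in>UNIV. indicator {s'} (f t \<omega> s a) * boot t \<omega> s') = boot t \<omega> (f t \<omega> s a)"
        by (simp add: indicator_def of_bool_def if_distrib[of "\<lambda>x. x * _"] cong: if_cong)
      ultimately show ?thesis using iteration[OF Suc.prems(1), of \<omega> t s a] by (simp add: True boot_def)
    qed
    then show ?thesis by (subst measurable_cong) (assumption, measurable)
  qed
qed

lemmas boot_measurable = boot_measurable_if[OF Q_measurable]

lemma magnitude_measurable: "magnitude t \<in> borel_measurable (F t)"
proof -
  \<comment> \<open>\<open>None\<close> stands for the entry 1, so that the maximum ranges over a
    single finite family of functions.\<close>
  have "magnitude t = (\<lambda>\<omega>. Max ((\<lambda>k. case k of None \<Rightarrow> 1 | Some (i, \<tau>, s, a) \<Rightarrow> \<bar>scaled_error i \<tau> \<omega> s a\<bar>) ` insert None (Some ` past t)))"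
    by (simp add: magnitude_def[abs_def] image_image)
  also have "\<dots> \<in> borel_measurable (F t)"
  proof (rule borel_measurable_Max)
    fix k assume k: "k \<in> insert None (Some ` past t)"
    show "(\<lambda>\<omega>. case k of None \<Rightarrow> 1 | Some (i, \<tau>, s, a) \<Rightarrow> \<bar>scaled_error i \<tau> \<omega> s a\<bar>) \<in> borel_measurable (F t)"
    proof (cases k)
      case (Some k')
      obtain i \<tau> s a where k': "k' = (i, \<tau>, s, a)" by (cases k') auto
      then have "(\<lambda>\<omega>. Q i \<tau> \<omega> s a) \<in> borel_measurable (F t)"
        using k Some by (intro Q_measurable) (auto simp: past_def)
      then show ?thesis by (simp add: Some k' scaled_error_def)
    qed simp
  qed (simp add: finite_past)
  finally show ?thesis .
qed

lemma boot_le: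
  assumes z: "zero_preserved \<omega>"
    and c: "\<And>i j a. i \<in> {1..N} \<Longrightarrow> j < K \<Longrightarrow> \<bar>scaled_error i (int t - int j) \<omega> s a\<bar> \<le> c"
  shows "\<bar>boot t \<omega> s - optimal_value R p \<gamma> s\<bar> \<le> c * \<xi> s"
  unfolding boot_def optimal_value_bellman
proof (rule bootstrap_nonexpansive[OF bootstrap N K])
  fix i j a assume ij: "i \<in> {1..N}" "j < K"
  \<comment> \<open>At weight 0 the scaled error carries no information; there the estimate and the
    optimal action value are both 0.\<close>
  show "\<bar>Q i (int t - int j) \<omega> s a - optimal_action_value R p \<gamma> s a\<bar> \<le> c * \<xi> s"
  proof (cases "\<xi> s = 0")
    case True
    then show ?thesis
      using z ij window[OF ij(2), of t] optimal_action_value_zero_weight[OF True] by (simp add: zero_preserved_def)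
  next
    case False
    then have "0 < \<xi> s" using weight_nonneg[of s] by simp
    then show ?thesis using c[OF ij, of a] by (simp add: scaled_error_def abs_divide pos_divide_le_eq)
  qed
qed

lemma drift_le:
  assumes z: "zero_preserved \<omega>"
    and c: "\<And>i j s a. i \<in> {1..N} \<Longrightarrow> j < K \<Longrightarrow> \<bar>scaled_error i (int t - int j) \<omega> s a\<bar> \<le> c" "0 \<le> c"
  shows "\<bar>drift s a t \<omega>\<bar> \<le> \<beta> * c"
proof (cases "\<xi> s = 0")
  case True
  then show ?thesis using c(2) \<beta> by (simp add: drift_def)
next
  case False
  then have "0 < \<xi> s" using weight_nonneg[of s] by simp
  moreover have "\<bar>\<gamma> * (\<Sum>s'\<in>UNIV. pmf (p s a) s' * (boot t \<omega> s' - optimal_value R p \<gamma> s'))\<bar> \<le> c * \<beta> * \<xi> s"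
    using boot_le[OF z c(1)] c(2) by (intro discounted_average_abs_le) auto
  ultimately show ?thesis by (simp add: drift_def abs_divide pos_divide_le_eq mult_ac)
qed

lemma scaled_error_Suc:
  assumes z: "zero_preserved \<omega>" and i: "i \<in> {1..N}"
  shows "scaled_error i (int (Suc t)) \<omega> s a =
    (1 - \<alpha> i t \<omega> s a) * scaled_error i (int t) \<omega> s a +
    \<alpha> i t \<omega> s a * (drift s a t \<omega> + magnitude t \<omega> * noise s a t \<omega>)"
proof (cases "\<xi> s = 0")
  case True
  then show ?thesis by (simp add: scaled_error_def drift_def noise_def)
next
  case False
  let ?Qs = "optimal_action_value R p \<gamma> s a" and ?a = "\<alpha> i t \<omega> s a"
  define G where "G = \<gamma> * (\<Sum>s'\<in>UNIV. pmf (p s a) s' * (boot t \<omega> s' - optimal_value R p \<gamma> s'))"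
  define W where "W = reward_noise s a t \<omega> + \<gamma> * (\<Sum>s'\<in>UNIV. boot t \<omega> s' * successor_noise s a s' t \<omega>)"
  have "(\<Sum>s'\<in>UNIV. boot t \<omega> s' * indicator {s'} (f t \<omega> s a)) = boot t \<omega> (f t \<omega> s a)"
    by (simp add: indicator_def of_bool_def if_distrib[of "\<lambda>x. _ * x"] cong: if_cong)
  then have sum: "(\<Sum>s'\<in>UNIV. boot t \<omega> s' * successor_noise s a s' t \<omega>) =
      boot t \<omega> (f t \<omega> s a) - (\<Sum>s'\<in>UNIV. pmf (p s a) s' * boot t \<omega> s')"
    by (simp add: successor_noise_def right_diff_distrib sum_subtractf mult.commute)
  \<comment> \<open>The mean of the bootstrap value is added in \<open>G\<close> and subtracted in
    \<open>W\<close>: \<open>G\<close> is known at time \<open>t\<close>, while \<open>W\<close>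
    consists of innovations with known coefficients.\<close>
  have target: "r t \<omega> s a + \<gamma> * boot t \<omega> (f t \<omega> s a) - ?Qs = G + W"
    unfolding G_def W_def sum
    by (simp add: optimal_action_value_def reward_noise_def right_diff_distrib sum_subtractf)
  have "\<omega> \<in> space M" using z by (simp add: zero_preserved_def)
  then have "Q i (int (Suc t)) \<omega> s a = Q i (int t) \<omega> s a + ?a * (r t \<omega> s a + \<gamma> * boot t \<omega> (f t \<omega> s a) - Q i (int t) \<omega> s a)"
    using iteration[OF i, of \<omega> t s a] by (simp add: boot_def add.commute)
  also have "\<dots> = Q i (int t) \<omega> s a + ?a * (?Qs + (G + W) - Q i (int t) \<omega> s a)"
    using target by (simp add: algebra_simps)
  finally have "Q i (int (Suc t)) \<omega> s a - ?Qs = (1 - ?a) * (Q i (int t) \<omega> s a - ?Qs) + ?a * (G + W)"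
    by (simp add: algebra_simps)
  then have "scaled_error i (int (Suc t)) \<omega> s a =
      (1 - ?a) * scaled_error i (int t) \<omega> s a + ?a * (G / \<xi> s + W / \<xi> s)"
    by (simp add: scaled_error_def add_divide_distrib distrib_left)
  moreover have "drift s a t \<omega> = G / \<xi> s" by (simp add: drift_def G_def)
  moreover have "magnitude t \<omega> * noise s a t \<omega> = W / \<xi> s"
    using magnitude_ge_1[of t \<omega>] by (simp add: noise_def W_def)
  ultimately show ?thesis by simp
qed

text \<open>A state of weight 0 almost surely returns to itself with reward 0, so its updates
  combine only values at the same state, which are 0 by induction.\<close>

lemma AE_zero_preserved: "AE \<omega> in M. zero_preserved \<omega>"
proof -
  have "AE \<omega> in M. \<xi> s = 0 \<longrightarrow> r t \<omega> s a = 0 \<and> f t \<omega> s a = s" for t s a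
  proof (cases "\<xi> s = 0")
    case True
    have "AE x in measure_pmf (p s a). x \<in> {s}"
      using zero_weight_absorbing[OF True, of a] by (subst measure_pmf.prob_eq_1[symmetric]) (auto simp: measure_pmf_single)
    then have "AE x in distr M (measure_pmf (p s a)) (\<lambda>\<omega>. f t \<omega> s a). x \<in> {s}"
      unfolding distr_successor(2) .
    from AE_distrD[OF distr_successor(1) this] have "AE \<omega> in M. f t \<omega> s a \<in> {s}" .
    moreover have "AE \<omega> in M. r t \<omega> s a = 0"
    proof (rule AE_distrD[OF distr_reward(1)])
      show "AE x in distr M (R s a) (\<lambda>\<omega>. r t \<omega> s a). x = 0"
        unfolding distr_reward(2) using zero_weight_absorbing[OF True] by blast
    qed
    ultimately show ?thesis by eventually_elim simp
  qed simp
  then have "AE \<omega> in M. \<forall>t s a. \<xi> s = 0 \<longrightarrow> r t \<omega> s a = 0 \<and> f t \<omega> s a = s"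
    by (simp add: AE_all_countable)
  with AE_space show ?thesis
  proof eventually_elim
    case (elim \<omega>)
    have Q0: "i \<in> {1..N} \<Longrightarrow> \<tau> \<in> {- int K + 1..int t} \<Longrightarrow> \<xi> s = 0 \<Longrightarrow> Q i \<tau> \<omega> s a = 0" for i \<tau> t s a
    proof (induction t arbitrary: i \<tau> a)
      case 0
      then show ?case using elim(1) by (intro initial_zero) auto
    next
      case (Suc t)
      show ?case
      proof (cases "\<tau> = int t + 1")
        case True
        \<comment> \<open>Nonexpansiveness with reference value and bound both 0 shows that the
          bootstrap value vanishes, for all three variants at once.\<close>
        have "\<bar>B (\<lambda>j \<tau>. Q j \<tau> \<omega>) (int t) s - (MAX a\<in>(UNIV :: 'a set). 0)\<bar> \<le> 0"
        proof (rule bootstrap_nonexpansive[OF bootstrap N K])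
          fix i j a assume "i \<in> {1..N}" "j < K"
          then show "\<bar>Q i (int t - int j) \<omega> s a - 0\<bar> \<le> 0"
            using Suc.IH[OF _ window Suc.prems(3)] by simp
        qed
        moreover have "Q i (int t) \<omega> s a = 0"
          by (rule Suc.IH[OF Suc.prems(1) _ Suc.prems(3)]) (use K in auto)
        ultimately show ?thesis
          using iteration[OF Suc.prems(1) elim(1), of t s a] elim(2) Suc.prems(3) by (simp add: True)
      next
        case False
        then show ?thesis using Suc by auto
      qed
    qed
    have "Q i \<tau> \<omega> s a = 0" if "i \<in> {1..N}" "- int K + 1 \<le> \<tau>" "\<xi> s = 0" for i \<tau> s a
    proof -
      have "\<tau> \<in> {- int K + 1..int (nat \<tau>)}" using that(2) by auto
      from Q0[OF that(1) this that(3)] show ?thesis .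
    qed
    then show ?case using elim(1) by (simp add: zero_preserved_def)
  qed
qed

text \<open>After division by \<open>magnitude\<close> the coefficients \<open>d\<close> and
  \<open>d'\<close> are almost surely bounded by constants. So they are square integrable against
  the steps, although the initial values need not be integrable.\<close>

lemma noise_converges:
  assumes i: "i \<in> {1..N}"
  shows "AE \<omega> in M. convergent (\<lambda>n. \<Sum>t<n. \<alpha> i t \<omega> s a * noise s a t \<omega>)"
proof -
  define d where "d t \<omega> = 1 / (magnitude t \<omega> * \<xi> s)" for t \<omega>
  define d' where "d' s' t \<omega> = \<gamma> * boot t \<omega> s' / (magnitude t \<omega> * \<xi> s)" for s' t \<omega>
  note [measurable] = magnitude_measurable boot_measurable
  have d_meas: "d t \<in> borel_measurable (F t)" "d' s' t \<in> borel_measurable (F t)" for s' t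
    unfolding d_def d'_def by measurable
  have d_le: "\<bar>d t \<omega>\<bar> \<le> 1 / \<xi> s" for t \<omega>
  proof (cases "\<xi> s = 0")
    case False
    then have "0 < \<xi> s" using weight_nonneg[of s] by simp
    then show ?thesis using magnitude_ge_1[of t \<omega>] by (simp add: d_def abs_mult divide_simps)
  qed (simp add: d_def)
  have d'_le: "AE \<omega> in M. \<bar>d' s' t \<omega>\<bar> \<le> \<gamma> * (\<bar>optimal_value R p \<gamma> s'\<bar> + \<xi> s') / \<xi> s" for s' t
    using AE_zero_preserved
  proof eventually_elim
    case (elim \<omega>)
    let ?m = "magnitude t \<omega>" and ?V = "\<bar>optimal_value R p \<gamma> s'\<bar>"
    have m: "1 \<le> ?m" by (rule magnitude_ge_1)
    have "\<bar>boot t \<omega> s' - optimal_value R p \<gamma> s'\<bar> \<le> ?m * \<xi> s'"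
      by (rule boot_le[OF elim]) (rule scaled_error_le_magnitude, simp, rule window, simp)
    \<comment> \<open>Since \<open>?m \<ge> 1\<close>, the part of the bootstrap value that does not
      scale with the errors is dominated as well.\<close>
    moreover have "?V \<le> ?m * ?V" using mult_right_mono[OF m, of ?V] by simp
    ultimately have "\<bar>boot t \<omega> s'\<bar> \<le> ?m * (?V + \<xi> s')" by (simp add: distrib_left)
    then have "\<bar>boot t \<omega> s'\<bar> / ?m \<le> ?V + \<xi> s'" using m by (simp add: pos_divide_le_eq mult.commute)
    then have "\<gamma> * (\<bar>boot t \<omega> s'\<bar> / ?m) / \<xi> s \<le> \<gamma> * (?V + \<xi> s') / \<xi> s"
      using weight_nonneg discount_nonneg by (intro divide_right_mono mult_left_mono) auto
    moreover have "\<bar>d' s' t \<omega>\<bar> = \<gamma> * (\<bar>boot t \<omega> s'\<bar> / ?m) / \<xi> s"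
      using m weight_nonneg[of s] discount_nonneg by (simp add: d'_def abs_mult)
    ultimately show ?case by simp
  qed
  have "AE \<omega> in M. convergent (\<lambda>n. \<Sum>t<n. (\<alpha> i t \<omega> s a * d t \<omega>) * reward_noise s a t \<omega>)"
    by (rule step_weighted_noise_converges[OF innovations_reward noise_variance(1) i d_meas(1), where L="1 / \<xi> s"])
      (simp add: d_le)
  moreover have "AE \<omega> in M. convergent (\<lambda>n. \<Sum>t<n. (\<alpha> i t \<omega> s a * d' s' t \<omega>) * successor_noise s a s' t \<omega>)" for s'
    by (rule step_weighted_noise_converges[OF innovations_successor noise_variance(2) i d_meas(2) d'_le])
  then have "AE \<omega> in M. \<forall>s'. convergent (\<lambda>n. \<Sum>t<n. (\<alpha> i t \<omega> s a * d' s' t \<omega>) * successor_noise s a s' t \<omega>)"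
    by (simp add: AE_all_countable)
  ultimately show ?thesis
  proof eventually_elim
    case (elim \<omega>)
    have "convergent (\<lambda>n. \<Sum>s'\<in>UNIV. \<Sum>t<n. (\<alpha> i t \<omega> s a * d' s' t \<omega>) * successor_noise s a s' t \<omega>)"
      using elim(2) by (intro convergent_sum) auto
    from convergent_add[OF elim(1) this]
    have "convergent (\<lambda>n. (\<Sum>t<n. (\<alpha> i t \<omega> s a * d t \<omega>) * reward_noise s a t \<omega>) +
      (\<Sum>s'\<in>UNIV. \<Sum>t<n. (\<alpha> i t \<omega> s a * d' s' t \<omega>) * successor_noise s a s' t \<omega>))" .
    moreover have "\<alpha> i t \<omega> s a * noise s a t \<omega> = (\<alpha> i t \<omega> s a * d t \<omega>) * reward_noise s a t \<omega> +
      (\<Sum>s'\<in>UNIV. (\<alpha> i t \<omega> s a * d' s' t \<omega>) * successor_noise s a s' t \<omega>)" for t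
      unfolding noise_def d_def d'_def
      by (simp add: add_divide_distrib distrib_left sum_distrib_left sum_divide_distrib mult_ac)
    ultimately show ?case
      by (simp add: sum.distrib sum.swap[of _ "UNIV" "{..<_}"])
  qed
qed

theorem Q_converges:
  "AE \<omega> in M. \<forall>i\<in>{1..N}. \<forall>s a. (\<lambda>t. Q i (int t) \<omega> s a) \<longlonglongrightarrow> optimal_action_value R p \<gamma> s a"
proof -
  have "AE \<omega> in M. \<forall>i\<in>{1..N}. \<forall>s a. convergent (\<lambda>n. \<Sum>t<n. \<alpha> i t \<omega> s a * noise s a t \<omega>)"
    using noise_converges by (simp add: AE_ball_countable AE_all_countable)
  moreover have "AE \<omega> in M. \<forall>i\<in>{1..N}. \<forall>s a. filterlim (\<lambda>n. \<Sum>t<n. \<alpha> i t \<omega> s a) at_top sequentially"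
    using step_diverges by (simp add: AE_ball_countable AE_all_countable)
  ultimately show ?thesis
    using AE_zero_preserved
  proof eventually_elim
    case (elim \<omega>)
    note z = elim(3)
    then have \<omega>: "\<omega> \<in> space M" by (simp add: zero_preserved_def)
    define I where "I = {1..N} \<times> (UNIV :: 's set) \<times> (UNIV :: 'a set)"
    define x where "x = (\<lambda>(i, s, a) t. scaled_error i (int t) \<omega> s a)"
    define g where "g = (\<lambda>(i :: nat, s, a) t. drift s a t \<omega>)"
    define v where "v = (\<lambda>(i :: nat, s, a) t. noise s a t \<omega>)"
    define b where "b = (\<lambda>(i, s, a) t. \<alpha> i t \<omega> s a)"
    have x0: "x k \<longlonglongrightarrow> 0" if "k \<in> I" for k
    proof (rule async_contraction_converges[where I=I and x=x and g=g and v=v and a=b and m="\<lambda>t. magnitude t \<omega>" and \<beta>=\<beta>])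
      show "finite I" by (simp add: I_def)
      show "0 \<le> \<beta>" "\<beta> < 1" by (fact \<beta>)+
      show "0 \<le> b k t \<and> b k t \<le> 1" if "k \<in> I" for k t
        using that step_bounds[OF _ \<omega>] by (auto simp: I_def b_def)
      show "filterlim (\<lambda>n. \<Sum>t<n. b k t) at_top sequentially" if "k \<in> I" for k
        using that elim(2) by (auto simp: I_def b_def)
      show "x k (Suc t) = (1 - b k t) * x k t + b k t * (g k t + magnitude t \<omega> * v k t)" if "k \<in> I" for k t
        using that scaled_error_Suc[OF z] by (auto simp: I_def x_def b_def g_def v_def)
      show "\<bar>g k t\<bar> \<le> \<beta> * magnitude t \<omega>" if "k \<in> I" for k t
      proof -
        have "\<bar>drift s a t \<omega>\<bar> \<le> \<beta> * magnitude t \<omega>" for s a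
          using scaled_error_le_magnitude[OF _ window] magnitude_ge_1[of t \<omega>] by (intro drift_le[OF z]) auto
        then show ?thesis by (auto simp: g_def split: prod.split)
      qed
      show "eventually (\<lambda>t. \<bar>g k t\<bar> \<le> \<beta> * A) sequentially"
        if "k \<in> I" and ev: "\<And>l. l \<in> I \<Longrightarrow> eventually (\<lambda>t. \<bar>x l t\<bar> \<le> A) sequentially" for k A
      proof -
        have "eventually (\<lambda>t. \<forall>l\<in>I. \<bar>x l t\<bar> \<le> A) sequentially"
          by (rule eventually_ball_finite) (use ev in \<open>simp_all add: I_def\<close>)
        then obtain T where T: "\<And>t l. t \<ge> T \<Longrightarrow> l \<in> I \<Longrightarrow> \<bar>x l t\<bar> \<le> A"
          by (auto simp: eventually_sequentially)
        have A: "0 \<le> A" using T[OF order_refl \<open>k \<in> I\<close>] by linarith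
        \<comment> \<open>From \<open>T + K\<close> on, every delayed time \<open>t - j\<close> with
          \<open>j < K\<close> is at least \<open>T\<close>, and the subtraction of natural numbers
          is exact.\<close>
        have "\<bar>g k t\<bar> \<le> \<beta> * A" if t: "t \<ge> T + K" for t
        proof -
          have "\<bar>drift s a t \<omega>\<bar> \<le> \<beta> * A" for s a
          proof (rule drift_le[OF z _ A])
            fix i j s a assume "i \<in> {1..N}" "j < K"
            then show "\<bar>scaled_error i (int t - int j) \<omega> s a\<bar> \<le> A"
              using T[of "t - j" "(i, s, a)"] t by (simp add: I_def x_def of_nat_diff)
          qed
          then show ?thesis by (auto simp: g_def split: prod.split)
        qed
        then show ?thesis by (auto simp: eventually_sequentially)
      qed
      show "incseq (\<lambda>t. magnitude t \<omega>)" by (rule incseq_magnitude)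
      show "0 \<le> magnitude t \<omega>" for t using magnitude_ge_1[of t \<omega>] by linarith
      show "\<bar>x k t\<bar> \<le> magnitude t \<omega>" if "k \<in> I" for k t
      proof -
        have "\<bar>scaled_error i (int t) \<omega> s a\<bar> \<le> magnitude t \<omega>" if "i \<in> {1..N}" for i s a
          by (rule scaled_error_le_magnitude[OF that]) (use K in auto)
        then show ?thesis using that by (auto simp: I_def x_def)
      qed
      show "magnitude (Suc t) \<omega> \<le> magnitude t \<omega> \<or> (\<exists>k\<in>I. magnitude (Suc t) \<omega> \<le> \<bar>x k (Suc t)\<bar>)" for t
        using magnitude_Suc[of t \<omega>] by (force simp: I_def x_def)
      show "convergent (\<lambda>n. \<Sum>t<n. b k t * v k t)" if "k \<in> I" for k
        using that elim(1) by (auto simp: I_def b_def v_def)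
      show "k \<in> I" by (fact that)
    qed
    show ?case
    proof (intro ballI allI)
      fix i s a assume i: "i \<in> {1..N}"
      let ?Qs = "optimal_action_value R p \<gamma> s a"
      have "(\<lambda>t. scaled_error i (int t) \<omega> s a) \<longlonglongrightarrow> 0"
        using x0[of "(i, s, a)"] i by (simp add: I_def x_def)
      \<comment> \<open>Multiplying by \<open>\<xi> s\<close> undoes the scaling for positive
        weights; at weight 0 both the estimate and its limit are 0.\<close>
      then have "(\<lambda>t. ?Qs + \<xi> s * scaled_error i (int t) \<omega> s a) \<longlonglongrightarrow> ?Qs + \<xi> s * 0"
        by (intro tendsto_intros)
      moreover have "?Qs + \<xi> s * scaled_error i (int t) \<omega> s a = Q i (int t) \<omega> s a" for t
      proof (cases "\<xi> s = 0")
        case True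
        then show ?thesis
          using z i K optimal_action_value_zero_weight[OF True, of a] by (simp add: zero_preserved_def)
      qed (simp add: scaled_error_def)
      ultimately show "(\<lambda>t. Q i (int t) \<omega> s a) \<longlonglongrightarrow> ?Qs" by simp
    qed
  qed
qed

end

theorem mainTheorem5:
  fixes R :: "'s::finite \<Rightarrow> 'a::finite \<Rightarrow> real measure"
    and p :: "'s \<Rightarrow> 'a \<Rightarrow> 's pmf"
    and \<gamma> C :: real
    and N K :: nat
    and M :: "'w measure"
    and F :: "nat \<Rightarrow> 'w measure"
    and Q :: "nat \<Rightarrow> int \<Rightarrow> 'w \<Rightarrow> 's \<Rightarrow> 'a \<Rightarrow> real"
    and \<alpha> :: "nat \<Rightarrow> nat \<Rightarrow> 'w \<Rightarrow> 's \<Rightarrow> 'a \<Rightarrow> real"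
    and r :: "nat \<Rightarrow> 'w \<Rightarrow> 's \<Rightarrow> 'a \<Rightarrow> real"
    and f :: "nat \<Rightarrow> 'w \<Rightarrow> 's \<Rightarrow> 'a \<Rightarrow> 's"
    and B :: "(nat \<Rightarrow> int \<Rightarrow> 's \<Rightarrow> 'a \<Rightarrow> real) \<Rightarrow> int \<Rightarrow> 's \<Rightarrow> real"
  assumes reward_law: "\<And>s a. real_distribution (R s a)"
    and finite_variance: "\<And>s a. integrable (R s a) (\<lambda>x. x\<^sup>2)"
    and discount: "0 \<le> \<gamma>" "\<gamma> \<le> 1"
    and N: "N \<ge> 1" and K: "K \<ge> 1"
    and prob: "prob_space M"
    and history: "filtration (space M) F" "\<And>t. subalgebra M (F t)"
    and initial_measurable:
      "\<And>i \<tau> s a. i \<in> {1..N} \<Longrightarrow> \<tau> \<in> {- int K + 1..0} \<Longrightarrow>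
         (\<lambda>\<omega>. Q i \<tau> \<omega> s a) \<in> borel_measurable (F 0)"
    and step_measurable:
      "\<And>i t s a. i \<in> {1..N} \<Longrightarrow> (\<lambda>\<omega>. \<alpha> i t \<omega> s a) \<in> borel_measurable (F t)"
    and reward_measurable: "\<And>t s a. (\<lambda>\<omega>. r t \<omega> s a) \<in> borel_measurable (F (Suc t))"
    and successor_measurable:
      "\<And>t s a. (\<lambda>\<omega>. f t \<omega> s a) \<in> measurable (F (Suc t)) (count_space UNIV)"
    and samples:
      "\<And>t. has_cond_law M (F t) (\<lambda>\<omega> (s, a). (r t \<omega> s a, f t \<omega> s a)) (sample_law R p)"
    and bootstrap:
      "K = 1 \<and> B = ensemble_bootstrap N \<or>
       N = 1 \<and> B = averaged_bootstrap K \<or>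
       N = 1 \<and> B = historical_best_bootstrap K"
    and iteration:
      "\<And>i t \<omega> s a. i \<in> {1..N} \<Longrightarrow> \<omega> \<in> space M \<Longrightarrow>
         Q i (int t + 1) \<omega> s a =
           Q i (int t) \<omega> s a +
           \<alpha> i t \<omega> s a *
             (r t \<omega> s a + \<gamma> * B (\<lambda>j \<tau>. Q j \<tau> \<omega>) (int t) (f t \<omega> s a) - Q i (int t) \<omega> s a)"
    and step_bounds:
      "\<And>i t \<omega> s a. i \<in> {1..N} \<Longrightarrow> \<omega> \<in> space M \<Longrightarrow> 0 \<le> \<alpha> i t \<omega> s a \<and> \<alpha> i t \<omega> s a \<le> 1"
    and step_squares:
      "\<And>i s a. i \<in> {1..N} \<Longrightarrow>
         AE \<omega> in M. summable (\<lambda>t. (\<alpha> i t \<omega> s a)\<^sup>2) \<and> (\<Sum>t. (\<alpha> i t \<omega> s a)\<^sup>2) \<le> C"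
    and step_diverges:
      "\<And>i s a. i \<in> {1..N} \<Longrightarrow>
         AE \<omega> in M. filterlim (\<lambda>n. \<Sum>t<n. \<alpha> i t \<omega> s a) at_top sequentially"
    and cases:
      "\<gamma> < 1 \<or>
       \<gamma> = 1 \<and>
       (\<exists>s1. absorbing_reward_free R p s1 \<and>
             (\<forall>i\<in>{1..N}. \<forall>\<tau>\<in>{- int K + 1..0}. \<forall>\<omega>\<in>space M. \<forall>a. Q i \<tau> \<omega> s1 a = 0) \<and>
             (\<forall>\<pi>. proper_policy p s1 \<pi>))"
  shows "AE \<omega> in M. \<forall>i\<in>{1..N}. \<forall>s a.
           (\<lambda>t. Q i (int t) \<omega> s a) \<longlonglongrightarrow> optimal_action_value R p \<gamma> s a"
proof -
  have integrable: "integrable (R s a) (\<lambda>x. x)" for s a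
  proof -
    interpret R: real_distribution "R s a" by (rule reward_law)
    show ?thesis using R.square_integrable_imp_integrable[of "\<lambda>x. x"] finite_variance[of s a] by simp
  qed
  have converges: ?thesis
    if "weighted_mdp R p \<gamma> \<beta> \<xi>"
      and zero: "\<And>i \<tau> \<omega> s a. i \<in> {1..N} \<Longrightarrow> \<tau> \<in> {- int K + 1..0} \<Longrightarrow> \<omega> \<in> space M \<Longrightarrow> \<xi> s = 0 \<Longrightarrow> Q i \<tau> \<omega> s a = 0"
      and absorbing: "\<And>s a. \<xi> s = 0 \<Longrightarrow> pmf (p s a) s = 1 \<and> (AE x in R s a. x = 0)" for \<beta> \<xi>
  proof -
    have "q_learning R p \<gamma> \<beta> \<xi> M C N K F Q \<alpha> r f B"
    proof (intro q_learning.intro q_learning_axioms.intro)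
      show "weighted_mdp R p \<gamma> \<beta> \<xi>" by fact
      show "prob_space M" by (rule prob)
    qed (fact finite_variance N K history initial_measurable step_measurable reward_measurable
        successor_measurable samples bootstrap iteration step_bounds step_squares step_diverges zero absorbing)+
    then show ?thesis by (rule q_learning.Q_converges)
  qed
  from cases show ?thesis
  proof (elim disjE conjE exE)
    assume "\<gamma> < 1"
    \<comment> \<open>With constant weight 1 the discount factor itself is the contraction factor,
      and the conditions at weight 0 are vacuous.\<close>
    have "weighted_mdp R p \<gamma> \<gamma> (\<lambda>_. 1)"
    proof (intro weighted_mdp.intro)
      show "real_distribution (R s a)" "integrable (R s a) (\<lambda>x. x)" for s a
        by (fact reward_law integrable)+
    qed (use discount \<open>\<gamma> < 1\<close> in \<open>simp_all add: sum_pmf_eq_1\<close>)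
    then show ?thesis by (rule converges) simp_all
  next
    fix s1
    assume \<gamma>: "\<gamma> = 1" and s1: "absorbing_reward_free R p s1"
      and zero: "\<forall>i\<in>{1..N}. \<forall>\<tau>\<in>{- int K + 1..0}. \<forall>\<omega>\<in>space M. \<forall>a. Q i \<tau> \<omega> s1 a = 0"
      and proper: "\<forall>\<pi>. proper_policy p s1 \<pi>"
    have absorbing: "pmf (p s1 a) s1 = 1" "AE x in R s1 a. x = 0" for a
      using s1 by (auto simp: absorbing_reward_free_def)
    obtain \<xi> \<beta> where w: "0 \<le> \<beta>" "\<beta> < 1" "\<And>s. 0 \<le> \<xi> s" "\<And>s. \<xi> s = 0 \<longleftrightarrow> s = s1"
      "\<And>s a. (\<Sum>s'\<in>UNIV. pmf (p s a) s' * \<xi> s') \<le> \<beta> * \<xi> s"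
      by (rule proper_policies_weights[of p s1, OF absorbing(1) spec[OF proper]]) (rule that)
    \<comment> \<open>The weights vanish at \<open>s1\<close> only, so the conditions at weight 0
      are the hypotheses on the absorbing state.\<close>
    have "weighted_mdp R p \<gamma> \<beta> \<xi>"
    proof (intro weighted_mdp.intro)
      show "(\<integral>x. x \<partial>R s a) = 0" if "\<xi> s = 0" for s a
        using that w(4) absorbing(2)[of a] by (simp add: integral_eq_zero_AE)
      show "real_distribution (R s a)" "integrable (R s a) (\<lambda>x. x)" for s a
        by (fact reward_law integrable)+
    qed (use w \<gamma> in simp_all)
    then show ?thesis by (rule converges) (use w(4) zero absorbing in auto)
  qed
qed

end
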